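(* Let $A$ be a PBW-reduction-algebra with weight vectors $\mathbf{v},\mathbf{w}$, and let $L\subseteq A^E$, $M=A^E/L$, the $F_0^{\mathbf{v}}A$-submodule $V=F^{\mathbf{v}}_0A\cdot\overline{V'}\subseteq M$, the shift vector $\mathbf{s}\in\mathbb{Z}^E$, the integer $k$, the finite set $V_k'\subseteq A^E$ and the $F_0^{\mathbf{v}}A$-module $V_k=\sum_{v\in V_k'}F^{\mathbf{v}}_0A\cdot v\subseteq A^E$ be as specified in the context. Then $$F^{\mathbf{w}}[\mathbf{s}]_{l}V=\sum_{v\in V_k'}\bigl(F^{\mathbf{w}}_{l-\deg_{\mathbf{w}[\mathbf{s}]}(v)}F^{\mathbf{v}}_0A\bigr)\cdot\overline v\quad\text{for all }l\in\mathbb{Z}$$ if and only if $$\operatorname{Gr}^{\mathbf{w}[\mathbf{s}]}(V_k)\cap\operatorname{Gr}^{\mathbf{w}[\mathbf{s}]}(L)=\operatorname{Gr}^{\mathbf{w}[\mathbf{s}]}(V_k\cap L),$$ where all associated graded modules are regarded as submodules of $\operatorname{Gr}^{\mathbf{w}[\mathbf{s}]}(A^E)$.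
   Context: **PBW-reduction-algebras.** $\mathbb{K}$ is a field, $\mathbb{K}\langle\underline x\rangle=\mathbb{K}\langle x_1,\dots,x_n\rangle$ the free algebra, $\mathbb{K}[\underline x]$ its $\mathbb{K}$-subspace spanned by the standard monomials $\underline x^\alpha=x_1^{\alpha_1}\cdots x_n^{\alpha_n}$. A monomial ordering on $\{\underline x^\alpha(e)\mid\alpha\in\mathbb{N}^n,e\in E\}$ ($E$ finite, $R^E=\bigoplus_{e\in E}R(e)$) is a total order compatible with adding exponents; it is a well-ordering if $(e)\preceq\underline x^\alpha(e)$ always. A commutation system $(S,\prec)$ is a monomial ordering $\prec$ on standard monomials and $S=\{x_jx_i-c_{ij}x_ix_j-d_{ij}\mid i<j\}$ with $c_{ij}\in\mathbb{K}^*$, $d_{ij}\in\mathbb{K}[\underline x]$, $d_{ij}=0$ or $\operatorname{lm}(d_{ij})\prec x_ix_j$, such that every element of $\mathbb{K}\langle\underline x\rangle$ is transformed into one of $\mathbb{K}[\underline x]$ by finitely many $\mathbb{K}$-linear replacements of a monomial $m\,x_jx_i\,m'$ by $m(c_{ij}x_ix_j+d_{ij})m'$. With $\operatorname{l}_\prec(G)$ the set of leading exponents of nonzero elements of $G\subseteq\mathbb{K}[\underline x]$ and $\operatorname{L}_\prec(G)=\operatorname{l}_\prec(G)+\mathbb{N}^n$, a PBW-reduction datum $(\mathbb{K}\langle\underline x\rangle,S,I,\prec)$ is a commutation system with $\prec$ a well-ordering and a finite $I\subseteq\mathbb{K}[\underline x]$ with $\operatorname{L}_\prec(I)=\operatorname{l}_\prec(\langle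 I\cup S\rangle\cap\mathbb{K}[\underline x])$; it defines the PBW-reduction-algebra $A=\mathbb{K}\langle\underline x\rangle/\langle I\cup S\rangle$, written $A=(\mathbb{K}\langle\underline x\rangle,S,I,\prec)$. An ordering on $A$ is a monomial ordering $\prec'$ such that $(S,\prec')$ is a commutation system. **Weight filtrations.** For $\mathbf{u}\in\mathbb{Z}^n$, $\mathbf{s}\in\mathbb{Z}^E$, assign degree $\mathbf{u}_i$ to $x_i$ and $\mathbf{s}_e$ to $(e)$; $\deg_{\mathbf{u}[\mathbf{s}]}$ of an element of $\mathbb{K}\langle\underline x\rangle^E$ is the maximal degree of its monomials. $F^{\mathbf{u}}[\mathbf{s}]_kA^E$ is the image of the elements of degree $\le k$; $\deg_{\mathbf{u}[\mathbf{s}]}(a)=\inf\{k\mid a\in F^{\mathbf{u}}[\mathbf{s}]_kA^E\}$ for $a\in A^E$ (with $F_\infty A=A$). Submodules and subalgebras carry the induced filtration by intersection, quotients the quotient filtration; $F^{\mathbf{w}}_kF^{\mathbf{v}}_0A=F^{\mathbf{w}}_kA\cap F^{\mathbf{v}}_0A$. $\operatorname{Gr}^{\mathbf{w}[\mathbf{s}]}(N)=\bigoplus_kF^{\mathbf{w}}[\mathbf{s}]_kN/F^{\mathbf{w}}[\mathbf{s}]_{k-1}N$. $\mathbf{u}$ is a weight vector on $A$ if $\deg_{\mathbf{u}}(d_{ij})\le\deg_{\mathbf{u}}(x_ix_j)$ for all $i<j$. For an ordering $\prec'$, $\prec'_{\mathbf{u}}$ compares first $\mathbf{u}$-degrees and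 then uses $\prec'$. A well-ordering $\prec'$ on $A$ is computable if a finite $I'$ with $A=(\mathbb{K}\langle\underline x\rangle,S,I',\prec')$ can be computed; a non-well-ordering is computable if one can compute a weight vector $\mathbf{y}\in\mathbb{N}_{>0}^n$ on $A$ such that the ordering $(\prec')^{\mathbf{y}}$ (compare $(1,\mathbf{y})$-degrees of $h^\alpha\underline x^\beta$, then $\underline x^\beta$ by $\prec'$) is computable on $A^{\mathbf{y}}$, the quotient of $\mathbb{K}\langle h,\underline x\rangle$ by the two-sided ideal generated by all $hx_i-x_ih$ and all $\mathbf{y}$-homogenizations (by $h$) of elements of $\langle S\cup I\rangle$. **Standing assumptions.** $\mathbf{v},\mathbf{w}\in\mathbb{Z}^n$ are weight vectors on $A=(\mathbb{K}\langle\underline x\rangle,S,I,\prec)$ with $F^{\mathbf{w}}_0A\subseteq F^{\mathbf{v}}_0A$. Let $G_A^{\mathbf{v}}$ be a finite set of standard monomials whose classes generate the algebra $F_0^{\mathbf{v}}A$ and $P_d^{A,\mathbf{v}}$ a finite set of standard monomials whose classes generate $F_d^{\mathbf{v}}A$ over $F_0^{\mathbf{v}}A$. It is assumed that: (1) a computable ordering of type $\prec'_{\mathbf{v}}$ on $A$ can be determined; (2) the kernel $K_{\mathbf{v}}$ of the surjection $A_{\mathbf{v}}:=\mathbb{K}\langle y_g\mid g\in G_A^{\mathbf{v}}\rangle\to F_0^{\mathbf{v}}A$, $y_g\mapsto\overline g$, can be determined and a PBW-reduction datum of $A_{\mathbf{v}}/K_{\mathbf{v}}$ is computable; (3) the filtration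 on $A_{\mathbf{v}}/K_{\mathbf{v}}$ corresponding to $F^{\mathbf{w}}_\bullet F^{\mathbf{v}}_0A$ is given by a weight vector $\mathbf{w}_{\mathbf{v}}$ on $A_{\mathbf{v}}/K_{\mathbf{v}}$ and a computable ordering of type $\prec''_{\mathbf{w}_{\mathbf{v}}}$ on it can be determined; (4) for each $d\in\mathbb{Z}$ one can determine $\mathbf{t}_d\in\mathbb{Z}^{P_d^{A,\mathbf{v}}}$ with $F^{\mathbf{w}}_\bullet F^{\mathbf{v}}_dA=\sum_{p\in P_d^{A,\mathbf{v}}}(F^{\mathbf{w}}_{\bullet-(\mathbf{t}_d)_p}F^{\mathbf{v}}_0A)\cdot\overline p$; (5) $F_0^{\mathbf{v}}A\cap F^{\mathbf{w}}_kA$ is the image in $A$ of $\{p\in\mathbb{K}[\underline x]\mid\deg_{\mathbf{v}}(p)\le0,\deg_{\mathbf{w}}(p)\le k\}$ for all $k$; (6) a computable ordering of type $\prec'''_{\mathbf{w}}$, with $\prec'''$ a well-ordering on $A$, can be determined; (7) (1) and (2) also hold with $A$ replaced by the PBW-reduction-algebra $\operatorname{Gr}^{\mathbf{w}}A$. **Setting of the claim.** $E$ is a finite set, $L\subseteq A^E$ the $A$-submodule generated by a finite set, $M=A^E/L$, $\mathbf{s}\in\mathbb{Z}^E$, $V'\subseteq A^E$ finite, $V$ the $F_0^{\mathbf{v}}A$-submodule of $M$ generated by the classes of $V'$, with $F^{\mathbf{w}}[\mathbf{s}]_lV=V\cap F^{\mathbf{w}}[\mathbf{s}]_lM$. It is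 assumed that there are finitely many elements $m_i\in V$ and integers $r_i$ with $F^{\mathbf{w}}[\mathbf{s}]_\bullet V=\sum_i(F^{\mathbf{w}}_{\bullet-r_i}F^{\mathbf{v}}_0A)m_i$. The integer $k$ is such that $F^{\mathbf{w}}[\mathbf{s}]_kV$ generates $V$ over $F^{\mathbf{v}}_0A$. The finite set $V'_k\subseteq A^E$ satisfies, with $V_k=\sum_{v\in V'_k}F_0^{\mathbf{v}}A\cdot v$: (i) $V_k+L=F_0^{\mathbf{v}}A\cdot V'+L$; (ii) $F^{\mathbf{w}}[\mathbf{s}]_{k'}V=\sum_{v\in V'_k}(F^{\mathbf{w}}_{k'-\deg_{\mathbf{w}[\mathbf{s}]}(v)}F^{\mathbf{v}}_0A)\cdot\overline v$ for all $k'\le k$; (iii) $F^{\mathbf{w}}[\mathbf{s}]_lV_k=\sum_{v\in V'_k}(F^{\mathbf{w}}_{l-\deg_{\mathbf{w}[\mathbf{s}]}(v)}F^{\mathbf{v}}_0A)\cdot v$ for all $l\in\mathbb{Z}$. *)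

theory Defs
  imports "HOL-Library.Poly_Mapping" "HOL-Library.Extended_Real" "HOL-Algebra.QuotRing"
    "HOL-Algebra.Module" "HOL-Algebra.Generated_Rings"
begin

section \<open>The free associative algebra\<close>

text \<open>
  Variables are numbered from 0, so that the letters of \<open>K\<langle>x\<^sub>1, \<dots>, x\<^sub>n\<rangle>\<close> are the numbers
  below \<open>n\<close>.  With concatenation as the (noncommutative) addition of words, the convolution
  product of \<^type>\<open>poly_mapping\<close> is the product of the free algebra.
\<close>

datatype word = Word (letters: "nat list")

instantiation word :: monoid_add
begin
definition zero_word :: word where "0 = Word []"
definition plus_word :: "word \<Rightarrow> word \<Rightarrow> word" where "u + v = Word (letters u @ letters v)"
instance by standard (simp_all add: zero_word_def plus_word_def)
end

type_synonym 'k falg = "word \<Rightarrow>\<^sub>0 'k"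
type_synonym expo = "nat \<Rightarrow>\<^sub>0 nat"

definition words :: "nat \<Rightarrow> word set" where
  "words n = {m. set (letters m) \<subseteq> {..<n}}"

definition free_alg :: "nat \<Rightarrow> 'k::field falg ring" where
  "free_alg n = \<lparr>carrier = {f. Poly_Mapping.keys f \<subseteq> words n}, mult = (*), one = 1, zero = 0, add = (+)\<rparr>"

abbreviation mon :: "word \<Rightarrow> 'k::field falg" where
  "mon m \<equiv> Poly_Mapping.single m 1"

abbreviation const :: "'k \<Rightarrow> 'k::field falg" where
  "const a \<equiv> Poly_Mapping.single 0 a"

definition expos :: "nat \<Rightarrow> expo set" where
  "expos n = {\<alpha>. Poly_Mapping.keys \<alpha> \<subseteq> {..<n}}"

definition std_word :: "expo \<Rightarrow> word" where
  "std_word \<alpha> = Word (concat (map (\<lambda>i. replicate (Poly_Mapping.lookup \<alpha> i) i)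
      (sorted_list_of_set (Poly_Mapping.keys \<alpha>))))"

text \<open>\<open>K[x]\<close>, which is only a linear subspace.\<close>

definition std_polys :: "nat \<Rightarrow> 'k::field falg set" where
  "std_polys n = {f. Poly_Mapping.keys f \<subseteq> std_word ` expos n}"


section \<open>Monomial orderings\<close>

text \<open>Orderings are the reflexive relations \<open>\<preceq>\<close> on exponent vectors.\<close>

definition monomial_ordering :: "nat \<Rightarrow> expo rel \<Rightarrow> bool" where
  "monomial_ordering n r \<longleftrightarrow> linear_order_on (expos n) r \<and>
     (\<forall>\<alpha> \<beta>. \<forall>\<gamma> \<in> expos n. (\<alpha>, \<beta>) \<in> r \<longrightarrow> (\<alpha> + \<gamma>, \<beta> + \<gamma>) \<in> r)"

definition well_ordering :: "nat \<Rightarrow> expo rel \<Rightarrow> bool" where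
  "well_ordering n r \<longleftrightarrow> (\<forall>\<alpha> \<in> expos n. (0, \<alpha>) \<in> r)"

definition lead_expo :: "nat \<Rightarrow> expo rel \<Rightarrow> 'k::field falg \<Rightarrow> expo" where
  "lead_expo n r f = (THE \<alpha>. \<alpha> \<in> expos n \<and> std_word \<alpha> \<in> Poly_Mapping.keys f \<and>
     (\<forall>\<beta> \<in> expos n. std_word \<beta> \<in> Poly_Mapping.keys f \<longrightarrow> (\<beta>, \<alpha>) \<in> r))"

definition lead_expos :: "nat \<Rightarrow> expo rel \<Rightarrow> 'k::field falg set \<Rightarrow> expo set" where
  "lead_expos n r G = lead_expo n r ` (G - {0})"

definition lead_ideal :: "nat \<Rightarrow> expo rel \<Rightarrow> 'k::field falg set \<Rightarrow> expo set" where
  "lead_ideal n r G = {\<alpha> + \<beta> | \<alpha> \<beta>. \<alpha> \<in> lead_expos n r G \<and> \<beta> \<in> expos n}"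


section \<open>Weights\<close>

definition word_wt :: "(nat \<Rightarrow> int) \<Rightarrow> word \<Rightarrow> int" where
  "word_wt u m = sum_list (map u (letters m))"

definition expo_wt :: "(nat \<Rightarrow> int) \<Rightarrow> expo \<Rightarrow> int" where
  "expo_wt u \<alpha> = (\<Sum>i \<in> Poly_Mapping.keys \<alpha>. u i * int (Poly_Mapping.lookup \<alpha> i))"

text \<open>Degrees live in \<^typ>\<open>ereal\<close>; the zero element has degree \<open>-\<infinity>\<close>.\<close>

abbreviation ext :: "int \<Rightarrow> ereal" where
  "ext k \<equiv> ereal (real_of_int k)"

definition wdeg :: "(nat \<Rightarrow> int) \<Rightarrow> 'k::field falg \<Rightarrow> ereal" where
  "wdeg u f = (SUP m \<in> Poly_Mapping.keys f. ext (word_wt u m))"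

definition wdeg_vec :: "'e set \<Rightarrow> (nat \<Rightarrow> int) \<Rightarrow> ('e \<Rightarrow> int) \<Rightarrow> ('e \<Rightarrow> 'k::field falg) \<Rightarrow> ereal" where
  "wdeg_vec E u s f = (SUP (e, m) \<in> (SIGMA e:E. Poly_Mapping.keys (f e)). ext (word_wt u m + s e))"

definition hcomp :: "(nat \<Rightarrow> int) \<Rightarrow> int \<Rightarrow> 'k::field falg \<Rightarrow> 'k falg" where
  "hcomp u k f = (\<Sum>m \<in> {m \<in> Poly_Mapping.keys f. word_wt u m = k}.
      Poly_Mapping.single m (Poly_Mapping.lookup f m))"

text \<open>The ordering \<open>\<prec>\<^sub>u\<close>.\<close>

definition weight_order :: "nat \<Rightarrow> (nat \<Rightarrow> int) \<Rightarrow> expo rel \<Rightarrow> expo rel" where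
  "weight_order n u r = {(\<alpha>, \<beta>). \<alpha> \<in> expos n \<and> \<beta> \<in> expos n \<and>
     (expo_wt u \<alpha> < expo_wt u \<beta> \<or> expo_wt u \<alpha> = expo_wt u \<beta> \<and> (\<alpha>, \<beta>) \<in> r)}"


section \<open>PBW-reduction-algebras\<close>

text \<open>
  The commutation relations are given by the families \<open>c\<^sub>i\<^sub>j\<close> and \<open>d\<^sub>i\<^sub>j\<close>, of which only
  the entries with \<open>i < j < n\<close> matter.
\<close>

record (overloaded) ('k::zero) pbw_datum =
  nvars :: nat
  ccoef :: "nat \<Rightarrow> nat \<Rightarrow> 'k"
  dpoly :: "nat \<Rightarrow> nat \<Rightarrow> 'k falg"
  rels :: "'k falg set"
  mord :: "expo rel"

definition comm_rels :: "nat \<Rightarrow> (nat \<Rightarrow> nat \<Rightarrow> 'k) \<Rightarrow> (nat \<Rightarrow> nat \<Rightarrow> 'k falg) \<Rightarrow> 'k::field falg set" where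
  "comm_rels n c d =
     {mon (Word [j, i]) - const (c i j) * mon (Word [i, j]) - d i j | i j. i < j \<and> j < n}"

text \<open>
  The linear map replacing the monomial \<open>m x\<^sub>j x\<^sub>i m'\<close> by \<open>m (c\<^sub>i\<^sub>j x\<^sub>i x\<^sub>j + d\<^sub>i\<^sub>j) m'\<close> and fixing all
  other monomials.
\<close>

definition replace ::
  "(nat \<Rightarrow> nat \<Rightarrow> 'k) \<Rightarrow> (nat \<Rightarrow> nat \<Rightarrow> 'k falg) \<Rightarrow> word \<Rightarrow> nat \<Rightarrow> nat \<Rightarrow> word \<Rightarrow> 'k::field falg \<Rightarrow> 'k falg" where
  "replace c d m j i m' f = (let a = Poly_Mapping.lookup f (m + Word [j, i] + m') in
     f - const a * mon (m + Word [j, i] + m')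
       + const a * (mon m * (const (c i j) * mon (Word [i, j]) + d i j) * mon m'))"

definition replace_step ::
  "nat \<Rightarrow> (nat \<Rightarrow> nat \<Rightarrow> 'k) \<Rightarrow> (nat \<Rightarrow> nat \<Rightarrow> 'k falg) \<Rightarrow> 'k::field falg \<Rightarrow> 'k falg \<Rightarrow> bool" where
  "replace_step n c d f g \<longleftrightarrow> (\<exists>m \<in> words n. \<exists>m' \<in> words n. \<exists>i j. i < j \<and> j < n \<and>
      g = replace c d m j i m' f)"

definition commutation_system ::
  "nat \<Rightarrow> (nat \<Rightarrow> nat \<Rightarrow> 'k) \<Rightarrow> (nat \<Rightarrow> nat \<Rightarrow> 'k::field falg) \<Rightarrow> expo rel \<Rightarrow> bool" where
  "commutation_system n c d r \<longleftrightarrow> monomial_ordering n r \<and>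
     (\<forall>i j. i < j \<and> j < n \<longrightarrow> c i j \<noteq> 0 \<and> d i j \<in> std_polys n \<and>
        (d i j = 0 \<or>
         (lead_expo n r (d i j), Poly_Mapping.single i 1 + Poly_Mapping.single j 1) \<in> r - Id)) \<and>
     (\<forall>f \<in> carrier (free_alg n). \<exists>g \<in> std_polys n. (replace_step n c d)\<^sup>*\<^sup>* f g)"

definition pbw_ideal :: "'k::field pbw_datum \<Rightarrow> 'k falg set" where
  "pbw_ideal D = genideal (free_alg (nvars D)) (rels D \<union> comm_rels (nvars D) (ccoef D) (dpoly D))"

definition pbw_reduction_datum :: "'k::field pbw_datum \<Rightarrow> bool" where
  "pbw_reduction_datum D \<longleftrightarrow>
     commutation_system (nvars D) (ccoef D) (dpoly D) (mord D) \<and>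
     well_ordering (nvars D) (mord D) \<and>
     finite (rels D) \<and> rels D \<subseteq> std_polys (nvars D) \<and>
     lead_ideal (nvars D) (mord D) (rels D) =
       lead_expos (nvars D) (mord D) (pbw_ideal D \<inter> std_polys (nvars D))"

definition pbw_alg :: "'k::field pbw_datum \<Rightarrow> 'k falg set ring" where
  "pbw_alg D = free_alg (nvars D) Quot pbw_ideal D"

definition cls :: "'k::field pbw_datum \<Rightarrow> 'k falg \<Rightarrow> 'k falg set" where
  "cls D f = pbw_ideal D +>\<^bsub>free_alg (nvars D)\<^esub> f"

definition ordering_on :: "'k::field pbw_datum \<Rightarrow> expo rel \<Rightarrow> bool" where
  "ordering_on D r \<longleftrightarrow> commutation_system (nvars D) (ccoef D) (dpoly D) r"

definition weight_vector :: "'k::field pbw_datum \<Rightarrow> (nat \<Rightarrow> int) \<Rightarrow> bool" where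
  "weight_vector D u \<longleftrightarrow>
     (\<forall>i j. i < j \<and> j < nvars D \<longrightarrow> wdeg u (dpoly D i j) \<le> ext (u i + u j))"


section \<open>Computable orderings\<close>

text \<open>
  Homogenization with respect to \<open>y\<close>, up to the degree \<open>N\<close>; the homogenizing variable \<open>h\<close>
  is number 0 and the old variables move up by one.
\<close>

definition homog_upto :: "(nat \<Rightarrow> int) \<Rightarrow> int \<Rightarrow> 'k::field falg \<Rightarrow> 'k falg" where
  "homog_upto y N f = (\<Sum>m \<in> Poly_Mapping.keys f.
     Poly_Mapping.single (Word (replicate (nat (N - word_wt y m)) 0 @ map Suc (letters m)))
       (Poly_Mapping.lookup f m))"

definition homog :: "(nat \<Rightarrow> int) \<Rightarrow> 'k::field falg \<Rightarrow> 'k falg" where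
  "homog y f = homog_upto y (Max (word_wt y ` Poly_Mapping.keys f)) f"

text \<open>The ideal defining \<open>A\<^sup>y\<close>.\<close>

definition homog_ideal :: "'k::field pbw_datum \<Rightarrow> (nat \<Rightarrow> int) \<Rightarrow> 'k falg set" where
  "homog_ideal D y = genideal (free_alg (Suc (nvars D)))
     ({mon (Word [0, Suc i]) - mon (Word [Suc i, 0]) | i. i < nvars D} \<union> homog y ` pbw_ideal D)"

text \<open>The ordering \<open>\<prec>\<^sup>y\<close>; \<open>map_key Suc\<close> sends the exponent of \<open>h\<^sup>a x\<^sup>\<beta>\<close> to \<open>\<beta>\<close>.\<close>

definition homog_order :: "nat \<Rightarrow> (nat \<Rightarrow> int) \<Rightarrow> expo rel \<Rightarrow> expo rel" where
  "homog_order n y r = {(\<alpha>, \<beta>). \<alpha> \<in> expos (Suc n) \<and> \<beta> \<in> expos (Suc n) \<and>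
     (expo_wt (case_nat 1 y) \<alpha> < expo_wt (case_nat 1 y) \<beta> \<or>
      expo_wt (case_nat 1 y) \<alpha> = expo_wt (case_nat 1 y) \<beta> \<and>
        (Poly_Mapping.map_key Suc \<alpha>, Poly_Mapping.map_key Suc \<beta>) \<in> r)}"

text \<open>
  The commutation system of \<open>A\<^sup>y\<close> consists of the homogenizations of the relations of \<open>A\<close>
  and of the relations \<open>x\<^sub>i h - h x\<^sub>i\<close>.
\<close>

definition homog_datum ::
  "'k::field pbw_datum \<Rightarrow> (nat \<Rightarrow> int) \<Rightarrow> 'k falg set \<Rightarrow> expo rel \<Rightarrow> 'k pbw_datum" where
  "homog_datum D y J r = \<lparr>
     nvars = Suc (nvars D),
     ccoef = (\<lambda>i j. if i = 0 then 1 else ccoef D (i - 1) (j - 1)),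
     dpoly = (\<lambda>i j. if i = 0 then 0
                    else homog_upto y (y (i - 1) + y (j - 1)) (dpoly D (i - 1) (j - 1))),
     rels = J,
     mord = r\<rparr>"

text \<open>
  That something can be computed or determined is rendered as its existence.
\<close>

definition computable_ordering :: "'k::field pbw_datum \<Rightarrow> expo rel \<Rightarrow> bool" where
  "computable_ordering D r \<longleftrightarrow> ordering_on D r \<and>
     (if well_ordering (nvars D) r
      then \<exists>J. pbw_reduction_datum (D\<lparr>rels := J, mord := r\<rparr>) \<and>
               pbw_ideal (D\<lparr>rels := J, mord := r\<rparr>) = pbw_ideal D
      else \<exists>y. (\<forall>i < nvars D. 0 < y i) \<and> weight_vector D y \<and>
             (\<exists>J. pbw_reduction_datum (homog_datum D y J (homog_order (nvars D) y r)) \<and>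
                  pbw_ideal (homog_datum D y J (homog_order (nvars D) y r)) = homog_ideal D y))"

definition has_computable_weight_ordering :: "'k::field pbw_datum \<Rightarrow> (nat \<Rightarrow> int) \<Rightarrow> bool" where
  "has_computable_weight_ordering D u \<longleftrightarrow>
     (\<exists>r. monomial_ordering (nvars D) r \<and> computable_ordering D (weight_order (nvars D) u r))"


section \<open>Modules\<close>

text \<open>
  Left modules over a noncommutative ring, as records of type \<^type>\<open>module\<close> whose fields
  \<open>mult\<close> and \<open>one\<close> are irrelevant.
\<close>

definition self_module :: "'a ring \<Rightarrow> ('a, 'a) module" where
  "self_module R = \<lparr>carrier = carrier R, mult = mult R, one = one R, zero = zero R, add = add R,
     smult = mult R\<rparr>"

definition free_module :: "'a ring \<Rightarrow> 'e set \<Rightarrow> ('a, 'e \<Rightarrow> 'a) module" where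
  "free_module R E = \<lparr>carrier = E \<rightarrow>\<^sub>E carrier R, mult = undefined, one = undefined,
     zero = (\<lambda>e \<in> E. \<zero>\<^bsub>R\<^esub>),
     add = (\<lambda>f g. \<lambda>e \<in> E. f e \<oplus>\<^bsub>R\<^esub> g e),
     smult = (\<lambda>a f. \<lambda>e \<in> E. a \<otimes>\<^bsub>R\<^esub> f e)\<rparr>"

definition quot_module :: "('a, 'b) module \<Rightarrow> 'b set \<Rightarrow> ('a, 'b set) module" where
  "quot_module N L = \<lparr>carrier = a_rcosets\<^bsub>N\<^esub> L, mult = undefined, one = undefined,
     zero = L,
     add = set_add N,
     smult = (\<lambda>a X. \<Union>x \<in> X. L +>\<^bsub>N\<^esub> (a \<odot>\<^bsub>N\<^esub> x))\<rparr>"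

definition gen_submodule :: "'a ring \<Rightarrow> ('a, 'b) module \<Rightarrow> 'b set \<Rightarrow> 'b set" where
  "gen_submodule R N X = \<Inter>{H. submodule H R N \<and> X \<subseteq> H}"

text \<open>The finite sum \<open>\<Sum>\<^sub>j C\<^sub>j y\<^sub>j\<close> for sets of scalars \<open>C\<^sub>j\<close>.\<close>

definition sum_multiples :: "('a, 'b) module \<Rightarrow> 'j set \<Rightarrow> ('j \<Rightarrow> 'a set) \<Rightarrow> ('j \<Rightarrow> 'b) \<Rightarrow> 'b set" where
  "sum_multiples N J C y = {(\<Oplus>\<^bsub>N\<^esub>j \<in> J. a j \<odot>\<^bsub>N\<^esub> y j) | a. \<forall>j \<in> J. a j \<in> C j}"


section \<open>Weight filtrations\<close>

text \<open>Filtration steps are indexed by \<^typ>\<open>ereal\<close>; the step \<open>\<infinity>\<close> is everything.\<close>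

definition Fil :: "'k::field pbw_datum \<Rightarrow> (nat \<Rightarrow> int) \<Rightarrow> ereal \<Rightarrow> 'k falg set set" where
  "Fil D u k = cls D ` {f \<in> carrier (free_alg (nvars D)). wdeg u f \<le> k}"

definition Fil_vec :: "'k::field pbw_datum \<Rightarrow> 'e set \<Rightarrow> (nat \<Rightarrow> int) \<Rightarrow> ('e \<Rightarrow> int) \<Rightarrow> ereal \<Rightarrow>
    ('e \<Rightarrow> 'k falg set) set" where
  "Fil_vec D E u s k = (\<lambda>f. \<lambda>e \<in> E. cls D (f e)) `
     {f \<in> E \<rightarrow> carrier (free_alg (nvars D)). wdeg_vec E u s f \<le> k}"

definition deg_vec :: "'k::field pbw_datum \<Rightarrow> 'e set \<Rightarrow> (nat \<Rightarrow> int) \<Rightarrow> ('e \<Rightarrow> int) \<Rightarrow>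
    ('e \<Rightarrow> 'k falg set) \<Rightarrow> ereal" where
  "deg_vec D E u s a = Inf {ext k | k. a \<in> Fil_vec D E u s (ext k)}"

text \<open>\<open>F\<^sup>v\<^sub>0 A\<close> as a ring of scalars.\<close>

definition F0_ring :: "'k::field pbw_datum \<Rightarrow> (nat \<Rightarrow> int) \<Rightarrow> 'k falg set ring" where
  "F0_ring D v = (pbw_alg D)\<lparr>carrier := Fil D v 0\<rparr>"

text \<open>
  The associated graded group of a filtration \<open>F\<close> by subgroups of \<open>N\<close>: the direct sum of the
  groups \<open>F\<^sub>k / F\<^sub>k\<^sub>-\<^sub>1\<close>, as families of cosets almost all of which are zero.
\<close>

definition assoc_gr :: "('b, 'm) ring_scheme \<Rightarrow> (int \<Rightarrow> 'b set) \<Rightarrow> (int \<Rightarrow> 'b set) set" where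
  "assoc_gr N F = {\<xi>. (\<forall>k. \<xi> k \<in> (\<lambda>a. F (k - 1) +>\<^bsub>N\<^esub> a) ` F k) \<and> finite {k. \<xi> k \<noteq> F (k - 1)}}"

text \<open>
  The canonical map into the associated graded group of a larger filtration \<open>F\<close>, sending the
  class \<open>F'\<^sub>k\<^sub>-\<^sub>1 + a\<close> to \<open>F\<^sub>k\<^sub>-\<^sub>1 + a\<close>.
\<close>

definition gr_incl :: "('b, 'm) ring_scheme \<Rightarrow> (int \<Rightarrow> 'b set) \<Rightarrow> (int \<Rightarrow> 'b set) \<Rightarrow> (int \<Rightarrow> 'b set)" where
  "gr_incl N F \<xi> = (\<lambda>k. F (k - 1) <+>\<^bsub>N\<^esub> \<xi> k)"

text \<open>\<open>Gr\<^bsup>w[s]\<^esup> N\<close> for a submodule \<open>N\<close> of \<open>A\<^sup>E\<close>, regarded as a submodule of \<open>Gr\<^bsup>w[s]\<^esup> (A\<^sup>E)\<close>.\<close>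

definition Gr_sub :: "'k::field pbw_datum \<Rightarrow> 'e set \<Rightarrow> (nat \<Rightarrow> int) \<Rightarrow> ('e \<Rightarrow> int) \<Rightarrow>
    ('e \<Rightarrow> 'k falg set) set \<Rightarrow> (int \<Rightarrow> ('e \<Rightarrow> 'k falg set) set) set" where
  "Gr_sub D E w s N =
     gr_incl (free_module (pbw_alg D) E) (\<lambda>k. Fil_vec D E w s (ext k)) `
       assoc_gr (free_module (pbw_alg D) E) (\<lambda>k. Fil_vec D E w s (ext k) \<inter> N)"


section \<open>Presentations of \<open>F\<^sup>v\<^sub>0 A\<close> and of \<open>Gr\<^sup>w A\<close>\<close>

text \<open>The algebra homomorphism with \<open>y\<^sub>i \<mapsto> x\<^bsup>gs ! i\<^esup>\<close>.\<close>

definition subst_mons :: "expo list \<Rightarrow> 'k::field falg \<Rightarrow> 'k falg" where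
  "subst_mons gs f = (\<Sum>m \<in> Poly_Mapping.keys f. const (Poly_Mapping.lookup f m) *
     prod_list (map (\<lambda>i. mon (std_word (gs ! i))) (letters m)))"

text \<open>
  The standard monomials with exponents \<open>gs\<close> generate the \<open>K\<close>-algebra \<open>F\<^sup>v\<^sub>0 A\<close>.
\<close>

definition generates_F0 :: "'k::field pbw_datum \<Rightarrow> (nat \<Rightarrow> int) \<Rightarrow> expo list \<Rightarrow> bool" where
  "generates_F0 D v gs \<longleftrightarrow> distinct gs \<and> set gs \<subseteq> expos (nvars D) \<and>
     generate_ring (pbw_alg D) (cls D ` (range const \<union> (\<lambda>\<alpha>. mon (std_word \<alpha>)) ` set gs)) = Fil D v 0"

text \<open>\<open>Dv\<close> is a PBW-reduction datum of \<open>A\<^sub>v / K\<^sub>v\<close>.\<close>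

definition presents_F0 :: "'k::field pbw_datum \<Rightarrow> expo list \<Rightarrow> 'k pbw_datum \<Rightarrow> bool" where
  "presents_F0 D gs Dv \<longleftrightarrow> pbw_reduction_datum Dv \<and> nvars Dv = length gs \<and>
     pbw_ideal Dv =
       {f \<in> carrier (free_alg (length gs)). cls D (subst_mons gs f) = \<zero>\<^bsub>pbw_alg D\<^esub>}"

text \<open>
  The kernel of the algebra homomorphism from the free algebra onto \<open>Gr\<^sup>w A\<close> that maps \<open>x\<^sub>i\<close>
  to its class in degree \<open>w\<^sub>i\<close>, and hence \<open>f\<close> to the family of the classes of its
  \<open>w\<close>-homogeneous components.
\<close>

definition gr_kernel :: "'k::field pbw_datum \<Rightarrow> (nat \<Rightarrow> int) \<Rightarrow> 'k falg set" where
  "gr_kernel D w = {f \<in> carrier (free_alg (nvars D)). \<forall>k.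
     Fil D w (ext (k - 1)) +>\<^bsub>pbw_alg D\<^esub> cls D (hcomp w k f) = Fil D w (ext (k - 1))}"

text \<open>
  \<open>DG\<close> is a PBW-reduction datum of \<open>Gr\<^sup>w A\<close> whose commutation relations are the
  \<open>w\<close>-initial forms of those of \<open>A\<close>.
\<close>

definition presents_Gr :: "'k::field pbw_datum \<Rightarrow> (nat \<Rightarrow> int) \<Rightarrow> 'k pbw_datum \<Rightarrow> bool" where
  "presents_Gr D w DG \<longleftrightarrow> pbw_reduction_datum DG \<and> nvars DG = nvars D \<and>
     (\<forall>i j. i < j \<and> j < nvars D \<longrightarrow>
        ccoef DG i j = ccoef D i j \<and> dpoly DG i j = hcomp w (w i + w j) (dpoly D i j)) \<and>
     pbw_ideal DG = gr_kernel D w"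

end

theory Submission
  imports Defs
begin

text \<open>
  Write \<open>N = A\<^sup>E\<close> with the filtration steps \<open>F\<^sub>l = F\<^sup>w[s]\<^sub>lN\<close>, and \<open>\<pi>\<close> for the projection modulo \<open>L\<close>.
  By (i) the module \<open>V\<close> is \<open>\<pi>(V\<^sub>k)\<close>, because \<open>\<pi>\<close> maps the \<open>F\<^sup>v\<^sub>0A\<close>-module generated by \<open>V'\<close> onto the one
  generated by the classes of \<open>V'\<close> and forgets summands from \<open>L\<close>.  By (iii) the right hand side of
  the formula for \<open>F\<^sup>w[s]\<^sub>lV\<close> is \<open>\<pi>(V\<^sub>k \<inter> F\<^sub>l)\<close>.  So the formula for all \<open>l\<close> is the strictness condition
  \<open>\<pi>(V\<^sub>k) \<inter> \<pi>(F\<^sub>l) = \<pi>(V\<^sub>k \<inter> F\<^sub>l)\<close>: a class with one representative in \<open>V\<^sub>k\<close> and another one in \<open>F\<^sub>l\<close>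
  has a representative that lies in both.

  That strictness is equivalent to \<open>Gr(V\<^sub>k) \<inter> Gr(L) = Gr(V\<^sub>k \<inter> L)\<close> holds for any two subgroups of an
  exhaustively filtered abelian group (\<open>strict_iff_gr_image_Int\<close>).  The equality of graded groups says
  that an initial form common to \<open>V\<^sub>k\<close> and \<open>L\<close> comes from \<open>V\<^sub>k \<inter> L\<close>.  Subtracting such common
  elements lowers the degree of a representative in \<open>V\<^sub>k\<close> step by step until it is in \<open>F\<^sub>l\<close>; since the
  representative one starts from has some finite degree, finitely many steps suffice.

  The projection \<open>\<pi>\<close> is compatible with generated submodules (\<open>proj_gen_submodule\<close>) and with sums of
  multiples (\<open>proj_sum_multiples\<close>), and the weight filtration of \<open>A\<^sup>E\<close> consists of subgroups and is
  exhaustive (\<open>filtered_free_module\<close>).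
\<close>


section \<open>Exhaustively filtered abelian groups\<close>

lemma (in abelian_group) rcos_eq_iff:
  assumes "additive_subgroup H G" "a \<in> carrier G" "b \<in> carrier G"
  shows "H +> a = H +> b \<longleftrightarrow> a \<ominus> b \<in> H"
proof -
  interpret H: abelian_subgroup H G
    by (rule abelian_subgroupI3[OF assms(1) abelian_group_axioms])
  show ?thesis
    using assms H.a_rcos_module H.a_rcos_self H.a_repr_independence' H.a_subgroup
    by (metis minus_eq)
qed

lemma (in abelian_group) additive_subgroup_Int:
  assumes "additive_subgroup H G" "additive_subgroup K G"
  shows "additive_subgroup (H \<inter> K) G"
  using assms add.subgroups_Inter_pair by (simp add: additive_subgroup_def)

lemma (in additive_subgroup) a_minus_closed:
  assumes "x \<in> H" "y \<in> H"
  shows "x \<ominus> y \<in> H"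
  using assms by (simp add: a_minus_def)

lemma (in abelian_group) minus_minus_cancel:
  assumes "a \<in> carrier G" "b \<in> carrier G"
  shows "a \<ominus> (a \<ominus> b) = b"
  using assms by (simp add: minus_eq minus_add a_assoc[symmetric] r_neg)

locale filtered_abelian_group = abelian_group G for G (structure) +
  fixes F :: "int \<Rightarrow> 'a set"
  assumes F_subgroup: "additive_subgroup (F l) G"
    and F_mono: "k \<le> l \<Longrightarrow> F k \<subseteq> F l"
    and F_exhaustive: "x \<in> carrier G \<Longrightarrow> \<exists>l. x \<in> F l"
begin

text \<open>\<open>Gr U\<close>, regarded inside \<open>Gr G\<close>.\<close>
definition gr_image :: "'a set \<Rightarrow> (int \<Rightarrow> 'a set) set" where
  "gr_image U = gr_incl G F ` assoc_gr G (\<lambda>l. F l \<inter> U)"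

text \<open>The degree \<open>l\<close> component of \<^const>\<open>gr_image\<close>, a set of elements of \<open>F\<^sub>l / F\<^sub>l\<^sub>-\<^sub>1\<close>.\<close>
definition initial_forms :: "'a set \<Rightarrow> int \<Rightarrow> 'a set set" where
  "initial_forms U l = (\<lambda>a. F (l - 1) +> a) ` (F l \<inter> U)"

lemma F_carrier: "x \<in> F l \<Longrightarrow> x \<in> carrier G"
  using F_subgroup additive_subgroup.a_Hcarr by metis

lemma add_F_rcos:
  assumes "additive_subgroup U G" "a \<in> U"
  shows "F l <+> (F l \<inter> U +> a) = F l +> a"
proof -
  interpret FU: additive_subgroup "F l \<inter> U" G
    by (rule additive_subgroup_Int[OF F_subgroup assms(1)])
  have a: "a \<in> carrier G" using assms by (rule additive_subgroup.a_Hcarr)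
  have "F l <+> (F l \<inter> U) = F l"
  proof
    show "F l <+> (F l \<inter> U) \<subseteq> F l"
      using additive_subgroup.a_closed[OF F_subgroup] by (auto simp: set_add_def')
    have "\<exists>y \<in> F l \<inter> U. x = x \<oplus> y" if "x \<in> F l" for x
      using FU.zero_closed F_carrier[OF that] by (metis r_zero)
    thus "F l \<subseteq> F l <+> (F l \<inter> U)" by (auto simp: set_add_def')
  qed
  thus ?thesis
    using a_setmult_rcos_assoc[of "F l" "F l \<inter> U" a] a FU.a_subset
      additive_subgroup.a_subset[OF F_subgroup] by metis
qed

text \<open>
  A family in \<open>Gr U\<close> may be chosen degree by degree, subject only to the finiteness of its
  support.  It does not matter whether the support is computed in \<open>Gr U\<close> or in \<open>Gr G\<close>, because
  \<open>(F\<^sub>l \<inter> U) / (F\<^sub>l\<^sub>-\<^sub>1 \<inter> U)\<close> embeds into \<open>F\<^sub>l / F\<^sub>l\<^sub>-\<^sub>1\<close>.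
\<close>
lemma gr_image_iff:
  assumes U: "additive_subgroup U G"
  shows "\<zeta> \<in> gr_image U \<longleftrightarrow> (\<forall>l. \<zeta> l \<in> initial_forms U l) \<and> finite {l. \<zeta> l \<noteq> F (l - 1)}"
proof
  assume "\<zeta> \<in> gr_image U"
  then obtain \<xi> where \<zeta>: "\<zeta> = gr_incl G F \<xi>"
    and \<xi>: "\<And>l. \<xi> l \<in> (\<lambda>a. F (l - 1) \<inter> U +> a) ` (F l \<inter> U)"
    and fin: "finite {l. \<xi> l \<noteq> F (l - 1) \<inter> U}"
    by (auto simp: gr_image_def assoc_gr_def)
  have "\<zeta> l \<in> initial_forms U l" for l
    using \<xi>[of l] add_F_rcos[OF U] by (auto simp: \<zeta> gr_incl_def initial_forms_def)
  moreover have "{l. \<zeta> l \<noteq> F (l - 1)} \<subseteq> {l. \<xi> l \<noteq> F (l - 1) \<inter> U}"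
  proof clarify
    fix l assume "\<zeta> l \<noteq> F (l - 1)" "\<xi> l = F (l - 1) \<inter> U"
    moreover have "F (l - 1) \<inter> U +> \<zero> = F (l - 1) \<inter> U" "F (l - 1) +> \<zero> = F (l - 1)"
      using additive_subgroup.a_subset F_subgroup U by (auto intro!: a_coset_add_zero)
    ultimately show False
      using add_F_rcos[OF U additive_subgroup.zero_closed[OF U], of "l - 1"]
      by (simp add: \<zeta> gr_incl_def)
  qed
  ultimately show "(\<forall>l. \<zeta> l \<in> initial_forms U l) \<and> finite {l. \<zeta> l \<noteq> F (l - 1)}"
    using fin finite_subset by blast
next
  assume \<zeta>: "(\<forall>l. \<zeta> l \<in> initial_forms U l) \<and> finite {l. \<zeta> l \<noteq> F (l - 1)}"
  then obtain b where b: "\<And>l. b l \<in> F l \<inter> U" "\<And>l. \<zeta> l = F (l - 1) +> b l"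
    unfolding initial_forms_def image_iff by metis
  \<comment> \<open>Taking \<open>\<zero>\<close> wherever \<open>\<zeta>\<close> vanishes keeps the support finite.\<close>
  define a where "a l = (if \<zeta> l = F (l - 1) then \<zero> else b l)" for l
  have a: "a l \<in> F l \<inter> U" "\<zeta> l = F (l - 1) +> a l" for l
    using b additive_subgroup.zero_closed[OF U] additive_subgroup.zero_closed[OF F_subgroup]
      a_coset_add_zero[OF additive_subgroup.a_subset[OF F_subgroup]]
    by (auto simp: a_def)
  define \<xi> where "\<xi> l = F (l - 1) \<inter> U +> a l" for l
  have "\<xi> l = F (l - 1) \<inter> U" if "\<zeta> l = F (l - 1)" for l
    using that additive_subgroup.a_subset[OF U] by (simp add: \<xi>_def a_def le_infI2)
  hence "{l. \<xi> l \<noteq> F (l - 1) \<inter> U} \<subseteq> {l. \<zeta> l \<noteq> F (l - 1)}"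
    by blast
  hence "\<xi> \<in> assoc_gr G (\<lambda>l. F l \<inter> U)"
    using a \<zeta> finite_subset by (fastforce simp: assoc_gr_def \<xi>_def)
  moreover have "\<zeta> = gr_incl G F \<xi>"
    using a add_F_rcos[OF U] by (fastforce simp: gr_incl_def \<xi>_def)
  ultimately show "\<zeta> \<in> gr_image U"
    unfolding gr_image_def by blast
qed

lemma zero_initial_form: "additive_subgroup U G \<Longrightarrow> F (l - 1) \<in> initial_forms U l"
  unfolding initial_forms_def
  by (rule image_eqI[of _ _ \<zero>])
    (auto simp: additive_subgroup.zero_closed F_subgroup additive_subgroup.a_subset)

text \<open>
  Intersecting subgroups of a direct sum that are themselves direct sums of their components can be
  done componentwise.  Families concentrated in one degree recover the components.
\<close>
lemma gr_image_Int_iff_initial_forms: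
  assumes U: "additive_subgroup U G" and W: "additive_subgroup W G"
  shows "gr_image U \<inter> gr_image W = gr_image (U \<inter> W) \<longleftrightarrow>
    (\<forall>l. initial_forms U l \<inter> initial_forms W l \<subseteq> initial_forms (U \<inter> W) l)"
proof -
  note iff = gr_image_iff[OF U] gr_image_iff[OF W] gr_image_iff[OF additive_subgroup_Int[OF U W]]
  have sub: "initial_forms (U \<inter> W) l \<subseteq> initial_forms U l \<inter> initial_forms W l" for l
    by (auto simp: initial_forms_def)
  show ?thesis
  proof
    assume eq: "gr_image U \<inter> gr_image W = gr_image (U \<inter> W)"
    show "\<forall>l. initial_forms U l \<inter> initial_forms W l \<subseteq> initial_forms (U \<inter> W) l"
    proof clarify
      fix l X assume X: "X \<in> initial_forms U l" "X \<in> initial_forms W l"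
      define \<zeta> where "\<zeta> = (\<lambda>j. F (j - 1))(l := X)"
      have "{j. \<zeta> j \<noteq> F (j - 1)} \<subseteq> {l}" by (auto simp: \<zeta>_def)
      hence "finite {j. \<zeta> j \<noteq> F (j - 1)}" by (rule finite_subset) simp
      hence "\<zeta> \<in> gr_image U \<inter> gr_image W"
        using X U W by (auto simp: iff \<zeta>_def zero_initial_form)
      hence "\<zeta> l \<in> initial_forms (U \<inter> W) l"
        using eq by (simp add: iff)
      thus "X \<in> initial_forms (U \<inter> W) l" by (simp add: \<zeta>_def)
    qed
  next
    assume "\<forall>l. initial_forms U l \<inter> initial_forms W l \<subseteq> initial_forms (U \<inter> W) l"
    hence "initial_forms (U \<inter> W) l = initial_forms U l \<inter> initial_forms W l" for l
      using sub by blast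
    thus "gr_image U \<inter> gr_image W = gr_image (U \<inter> W)"
      by (auto simp: iff)
  qed
qed

text \<open>
  The left hand side says that the projection modulo \<open>W\<close>, restricted to \<open>U\<close>, is strict: a class
  that has a representative in \<open>U\<close> and one in \<open>F\<^sub>l\<close> has a representative in both.

  If strictness holds and \<open>a \<in> U\<close>, \<open>b \<in> W\<close> of degree at most \<open>l\<close> have the same initial form, then
  \<open>a\<close> and \<open>a - b \<in> F\<^sub>l\<^sub>-\<^sub>1\<close> agree modulo \<open>W\<close>.  Strictness in degree \<open>l - 1\<close> gives
  \<open>c \<in> U \<inter> F\<^sub>l\<^sub>-\<^sub>1\<close> with the same class, and \<open>a - c \<in> U \<inter> W\<close> has the initial form of \<open>a\<close>.

  Conversely, if \<open>u \<in> U\<close> and \<open>f \<in> F\<^sub>l\<close> agree modulo \<open>W\<close> and \<open>u\<close> has degree \<open>m > l\<close>, then \<open>u\<close> and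
  \<open>u - f \<in> W\<close> have the same initial form in degree \<open>m\<close>.  It is therefore the initial form of some
  \<open>z \<in> U \<inter> W\<close>, and \<open>u - z\<close> represents the same class in lower degree.  By exhaustiveness finitely many
  such steps lead from any \<open>u\<close> into \<open>F\<^sub>l\<close>.
\<close>
theorem strict_iff_gr_image_Int:
  assumes U: "additive_subgroup U G" and W: "additive_subgroup W G"
  shows "(\<forall>l. (\<lambda>a. W +> a) ` U \<inter> (\<lambda>a. W +> a) ` F l = (\<lambda>a. W +> a) ` (U \<inter> F l)) \<longleftrightarrow>
    gr_image U \<inter> gr_image W = gr_image (U \<inter> W)"
    (is "?strict \<longleftrightarrow> _")
proof -
  interpret U: additive_subgroup U G by (rule U)
  interpret W: additive_subgroup W G by (rule W)
  note Fs = additive_subgroup.a_minus_closed[OF F_subgroup] F_subgroup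
  show ?thesis
    unfolding gr_image_Int_iff_initial_forms[OF U W]
  proof
    assume strict: ?strict
    show "\<forall>l. initial_forms U l \<inter> initial_forms W l \<subseteq> initial_forms (U \<inter> W) l"
    proof clarify
      fix l X assume "X \<in> initial_forms U l" "X \<in> initial_forms W l"
      then obtain a b where a: "a \<in> F l" "a \<in> U" "X = F (l - 1) +> a"
        and b: "b \<in> F l" "b \<in> W" "X = F (l - 1) +> b"
        by (auto simp: initial_forms_def)
      have ab: "a \<ominus> b \<in> F (l - 1)"
        using a b rcos_eq_iff[OF F_subgroup] F_carrier by metis
      have "a \<ominus> (a \<ominus> b) = b"
        using a b F_carrier by (intro minus_minus_cancel) auto
      hence "W +> a = W +> (a \<ominus> b)"
        using a b ab rcos_eq_iff[OF W] F_carrier by metis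
      hence "W +> a \<in> (\<lambda>a. W +> a) ` U \<inter> (\<lambda>a. W +> a) ` F (l - 1)"
        using a ab by blast
      hence "W +> a \<in> (\<lambda>a. W +> a) ` (U \<inter> F (l - 1))"
        using strict by simp
      then obtain c where c: "c \<in> U" "c \<in> F (l - 1)" "W +> a = W +> c"
        by auto
      have "a \<ominus> c \<in> W"
        using a c rcos_eq_iff[OF W] F_carrier by metis
      moreover have "a \<ominus> c \<in> F l"
        using Fs a c F_mono[of "l - 1" l] by auto
      moreover have "a \<ominus> (a \<ominus> c) = c"
        using a c F_carrier by (intro minus_minus_cancel) auto
      hence "X = F (l - 1) +> (a \<ominus> c)"
        using a c rcos_eq_iff[OF F_subgroup] F_carrier minus_closed by metis
      ultimately show "X \<in> initial_forms (U \<inter> W) l"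
        using a c U.a_minus_closed by (auto simp: initial_forms_def)
    qed
  next
    assume sym: "\<forall>l. initial_forms U l \<inter> initial_forms W l \<subseteq> initial_forms (U \<inter> W) l"
    \<comment> \<open>\<open>n\<close> bounds the excess of the degree of \<open>u\<close> over \<open>l\<close>.\<close>
    have descend: "\<exists>u' \<in> U \<inter> F l. W +> u' = W +> f"
      if "u \<in> U \<inter> F (l + int n)" "f \<in> F l" "W +> u = W +> f" for u f l n
      using that
    proof (induction n arbitrary: u)
      case 0
      thus ?case by auto
    next
      case (Suc n)
      let ?m = "l + int (Suc n)"
      have carr: "u \<in> carrier G" "f \<in> carrier G"
        using Suc.prems F_carrier by auto
      have f: "f \<in> F (?m - 1)" "f \<in> F ?m"
        using Suc.prems(2) F_mono[of l "?m - 1"] F_mono[of l ?m] by auto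
      have w: "u \<ominus> f \<in> W"
        using Suc.prems rcos_eq_iff[OF W carr] by blast
      have "u \<ominus> (u \<ominus> f) = f"
        using carr by (intro minus_minus_cancel) auto
      hence "F (?m - 1) +> u = F (?m - 1) +> (u \<ominus> f)"
        using carr f rcos_eq_iff[OF F_subgroup] minus_closed by metis
      hence "F (?m - 1) +> u \<in> initial_forms U ?m \<inter> initial_forms W ?m"
        using Suc.prems w Fs f unfolding initial_forms_def by blast
      hence "F (?m - 1) +> u \<in> initial_forms (U \<inter> W) ?m"
        using sym[rule_format, of ?m] by (rule rev_subsetD)
      then obtain z where z: "z \<in> U" "z \<in> W" "z \<in> F ?m" "F (?m - 1) +> u = F (?m - 1) +> z"
        unfolding initial_forms_def by blast
      have "u \<ominus> z \<in> F (?m - 1)"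
        using z carr rcos_eq_iff[OF F_subgroup] F_carrier by metis
      moreover have "u \<ominus> z \<in> U"
        using z(1) Suc.prems(1) U.a_minus_closed by simp
      moreover have "W +> (u \<ominus> z) = W +> f"
        using Suc.prems(3) z carr minus_minus_cancel rcos_eq_iff[OF W] F_carrier minus_closed
        by metis
      moreover have "?m - 1 = l + int n" by simp
      ultimately show ?case
        using Suc.IH[of "u \<ominus> z"] Suc.prems(2) by simp
    qed
    show ?strict
    proof (intro allI equalityI subsetI)
      fix l X assume "X \<in> (\<lambda>a. W +> a) ` U \<inter> (\<lambda>a. W +> a) ` F l"
      then obtain u f where uf: "u \<in> U" "f \<in> F l" "X = W +> f" "W +> u = W +> f"
        by auto
      obtain m where "u \<in> F m"
        using F_exhaustive uf(1) U.a_Hcarr by blast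
      moreover have "m \<le> l + int (nat (m - l))" by simp
      ultimately have "u \<in> F (l + int (nat (m - l)))"
        using F_mono by blast
      thus "X \<in> (\<lambda>a. W +> a) ` (U \<inter> F l)"
        using descend[of u l "nat (m - l)" f] uf by auto
    qed auto
  qed
qed

end


section \<open>Left modules and their quotients\<close>

text \<open>
  In contrast to \<^locale>\<open>module\<close>, the scalars may be noncommutative, as they are in
  PBW-reduction-algebras.
\<close>
locale left_module = R: ring R + abelian_group N for R :: "'a ring" (structure) and N :: "('a, 'b) module" (structure) +
  assumes smult_closed: "\<lbrakk>a \<in> carrier R; x \<in> carrier N\<rbrakk> \<Longrightarrow> a \<odot>\<^bsub>N\<^esub> x \<in> carrier N"
    and smult_l_distr: "\<lbrakk>a \<in> carrier R; b \<in> carrier R; x \<in> carrier N\<rbrakk> \<Longrightarrow>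
      (a \<oplus>\<^bsub>R\<^esub> b) \<odot>\<^bsub>N\<^esub> x = a \<odot>\<^bsub>N\<^esub> x \<oplus>\<^bsub>N\<^esub> b \<odot>\<^bsub>N\<^esub> x"
    and smult_r_distr: "\<lbrakk>a \<in> carrier R; x \<in> carrier N; y \<in> carrier N\<rbrakk> \<Longrightarrow>
      a \<odot>\<^bsub>N\<^esub> (x \<oplus>\<^bsub>N\<^esub> y) = a \<odot>\<^bsub>N\<^esub> x \<oplus>\<^bsub>N\<^esub> a \<odot>\<^bsub>N\<^esub> y"
    and smult_assoc: "\<lbrakk>a \<in> carrier R; b \<in> carrier R; x \<in> carrier N\<rbrakk> \<Longrightarrow>
      (a \<otimes>\<^bsub>R\<^esub> b) \<odot>\<^bsub>N\<^esub> x = a \<odot>\<^bsub>N\<^esub> (b \<odot>\<^bsub>N\<^esub> x)"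
    and smult_one: "x \<in> carrier N \<Longrightarrow> \<one>\<^bsub>R\<^esub> \<odot>\<^bsub>N\<^esub> x = x"
begin

lemma smult_l_zero:
  assumes x: "x \<in> carrier N"
  shows "\<zero>\<^bsub>R\<^esub> \<odot>\<^bsub>N\<^esub> x = \<zero>\<^bsub>N\<^esub>"
proof -
  have "\<zero>\<^bsub>R\<^esub> \<odot>\<^bsub>N\<^esub> x \<oplus>\<^bsub>N\<^esub> \<zero>\<^bsub>R\<^esub> \<odot>\<^bsub>N\<^esub> x = \<zero>\<^bsub>R\<^esub> \<odot>\<^bsub>N\<^esub> x"
    using smult_l_distr[of "\<zero>\<^bsub>R\<^esub>" "\<zero>\<^bsub>R\<^esub>" x] x by simp
  thus ?thesis
    using smult_closed[of "\<zero>\<^bsub>R\<^esub>" x] x by (simp add: add.l_cancel_one)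
qed

lemma smult_r_minus_distr:
  assumes "a \<in> carrier R" "x \<in> carrier N" "y \<in> carrier N"
  shows "a \<odot>\<^bsub>N\<^esub> (x \<ominus>\<^bsub>N\<^esub> y) = a \<odot>\<^bsub>N\<^esub> x \<ominus>\<^bsub>N\<^esub> a \<odot>\<^bsub>N\<^esub> y"
proof -
  have "a \<odot>\<^bsub>N\<^esub> x = a \<odot>\<^bsub>N\<^esub> ((x \<ominus>\<^bsub>N\<^esub> y) \<oplus>\<^bsub>N\<^esub> y)"
    using assms by (simp add: minus_eq a_assoc l_neg)
  also have "\<dots> = a \<odot>\<^bsub>N\<^esub> (x \<ominus>\<^bsub>N\<^esub> y) \<oplus>\<^bsub>N\<^esub> a \<odot>\<^bsub>N\<^esub> y"
    using assms by (intro smult_r_distr) auto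
  finally show ?thesis
    using assms by (simp add: minus_eq a_assoc r_neg smult_closed)
qed

lemma subgroup_sum_multiples:
  assumes "finite J" "y \<in> J \<rightarrow> carrier N" and C: "\<And>j. j \<in> J \<Longrightarrow> additive_subgroup (C j) R"
  shows "additive_subgroup (sum_multiples N J C y) N"
proof (rule additive_subgroupI)
  let ?s = "\<lambda>a. \<Oplus>\<^bsub>N\<^esub>j\<in>J. a j \<odot>\<^bsub>N\<^esub> y j"
  have carr: "(\<lambda>j. a j \<odot>\<^bsub>N\<^esub> y j) \<in> J \<rightarrow> carrier N" if "\<forall>j\<in>J. a j \<in> C j" for a
    using that assms(2) additive_subgroup.a_Hcarr[OF C] by (auto intro!: smult_closed)
  have add: "?s a \<oplus>\<^bsub>N\<^esub> ?s b = ?s (\<lambda>j. a j \<oplus>\<^bsub>R\<^esub> b j)"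
    if ab: "\<forall>j\<in>J. a j \<in> C j" "\<forall>j\<in>J. b j \<in> C j" for a b
  proof -
    have "?s a \<oplus>\<^bsub>N\<^esub> ?s b = (\<Oplus>\<^bsub>N\<^esub>j\<in>J. a j \<odot>\<^bsub>N\<^esub> y j \<oplus>\<^bsub>N\<^esub> b j \<odot>\<^bsub>N\<^esub> y j)"
      using carr ab by (intro finsum_addf[symmetric]) auto
    also have "\<dots> = ?s (\<lambda>j. a j \<oplus>\<^bsub>R\<^esub> b j)"
      using ab assms(2) additive_subgroup.a_Hcarr[OF C]
      by (intro finsum_cong') (auto simp: smult_l_distr Pi_iff intro!: smult_closed)
    finally show ?thesis .
  qed
  have zero: "?s (\<lambda>_. \<zero>\<^bsub>R\<^esub>) = \<zero>\<^bsub>N\<^esub>"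
  proof -
    have "?s (\<lambda>_. \<zero>\<^bsub>R\<^esub>) = (\<Oplus>\<^bsub>N\<^esub>j\<in>J. \<zero>\<^bsub>N\<^esub>)"
      using assms(2) by (intro finsum_cong') (auto simp: smult_l_zero Pi_iff)
    thus ?thesis by simp
  qed
  show "subgroup (sum_multiples N J C y) (add_monoid N)"
  proof (rule add.subgroupI)
    show "sum_multiples N J C y \<subseteq> carrier N"
      using carr by (auto simp: sum_multiples_def intro!: finsum_closed)
    show "sum_multiples N J C y \<noteq> {}"
      using additive_subgroup.zero_closed[OF C] by (fastforce simp: sum_multiples_def)
    show "X \<oplus>\<^bsub>N\<^esub> Y \<in> sum_multiples N J C y"
      if X: "X \<in> sum_multiples N J C y" and Y: "Y \<in> sum_multiples N J C y" for X Y
    proof -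
      from X Y obtain a b where "\<forall>j\<in>J. a j \<in> C j" "\<forall>j\<in>J. b j \<in> C j" "X = ?s a" "Y = ?s b"
        unfolding sum_multiples_def by blast
      thus ?thesis
        using add[of a b] additive_subgroup.a_closed[OF C] by (fastforce simp: sum_multiples_def)
    qed
    show "\<ominus>\<^bsub>N\<^esub> X \<in> sum_multiples N J C y" if X: "X \<in> sum_multiples N J C y" for X
    proof -
      from X obtain a where a: "\<forall>j\<in>J. a j \<in> C j" "X = ?s a"
        unfolding sum_multiples_def by blast
      define b where "b j = \<ominus>\<^bsub>R\<^esub> a j" for j
      have b: "\<forall>j\<in>J. b j \<in> C j"
        using a additive_subgroup.a_inv_closed[OF C] by (simp add: b_def)
      have "?s b \<oplus>\<^bsub>N\<^esub> X = ?s (\<lambda>j. b j \<oplus>\<^bsub>R\<^esub> a j)"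
        unfolding a(2) using add a(1) b by blast
      also have "\<dots> = ?s (\<lambda>_. \<zero>\<^bsub>R\<^esub>)"
        using a(1) assms(2) additive_subgroup.a_Hcarr[OF C]
        by (intro finsum_cong') (auto simp: b_def R.l_neg smult_l_zero Pi_iff)
      finally have "\<ominus>\<^bsub>N\<^esub> X = ?s b"
        using a(1) b carr zero unfolding a(2) by (intro minus_equality finsum_closed) auto
      thus ?thesis
        using b by (auto simp: sum_multiples_def)
    qed
  qed
qed

lemma submodule_iff:
  "submodule H S N \<longleftrightarrow> additive_subgroup H N \<and> (\<forall>a \<in> carrier S. \<forall>x \<in> H. a \<odot>\<^bsub>N\<^esub> x \<in> H)"
  by (auto simp: submodule_def submodule_axioms_def additive_subgroup_def)

end

lemma subset_gen_submodule: "Y \<subseteq> gen_submodule S N Y"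
  by (auto simp: gen_submodule_def)

lemma gen_submodule_minimal: "submodule H S N \<Longrightarrow> Y \<subseteq> H \<Longrightarrow> gen_submodule S N Y \<subseteq> H"
  by (auto simp: gen_submodule_def)

context left_module
begin

lemma submodule_gen_submodule:
  assumes "carrier S \<subseteq> carrier R" "Y \<subseteq> carrier N"
  shows "submodule (gen_submodule S N Y) S N"
proof -
  let ?\<H> = "{H. submodule H S N \<and> Y \<subseteq> H}"
  have "submodule (carrier N) S N"
    using assms(1) add.subgroup_self smult_closed by (auto simp: submodule_iff additive_subgroup_def)
  hence "subgroup (\<Inter>?\<H>) (add_monoid N)"
    using assms(2) by (intro add.subgroups_Inter) (auto simp: submodule_def)
  thus ?thesis
    by (auto simp: gen_submodule_def submodule_iff additive_subgroup_def)
qed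

end

locale submodule_of_left_module = left_module R N for R :: "'a ring" (structure) and N :: "('a, 'b) module" (structure) +
  fixes L
  assumes L: "submodule L R N"
begin

abbreviation quotient where "quotient \<equiv> quot_module N L"

abbreviation proj where "proj \<equiv> (\<lambda>x. L +>\<^bsub>N\<^esub> x)"

lemma L_subgroup: "additive_subgroup L N"
  using L by (simp add: submodule_iff)

sublocale L: abelian_subgroup L N
  by (rule abelian_subgroupI3[OF L_subgroup abelian_group_axioms])

lemma carrier_quotient: "carrier quotient = proj ` carrier N"
  by (auto simp: quot_module_def A_RCOSETS_def')

lemma proj_hom: "abelian_group_hom N quotient proj"
proof (rule abelian_group_homI)
  have add: "proj x \<oplus>\<^bsub>quotient\<^esub> proj y = proj (x \<oplus>\<^bsub>N\<^esub> y)"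
    if "x \<in> carrier N" "y \<in> carrier N" for x y
    using that by (simp add: quot_module_def L.a_rcos_sum)
  have zero: "\<zero>\<^bsub>quotient\<^esub> = proj \<zero>\<^bsub>N\<^esub>"
    by (simp add: quot_module_def L.a_subset)
  show quot: "abelian_group quotient"
  proof (rule abelian_groupI)
    fix X assume "X \<in> carrier quotient"
    then obtain x where "x \<in> carrier N" "X = proj x"
      by (auto simp: carrier_quotient)
    thus "\<exists>Y\<in>carrier quotient. Y \<oplus>\<^bsub>quotient\<^esub> X = \<zero>\<^bsub>quotient\<^esub>"
      by (intro bexI[of _ "proj (\<ominus>\<^bsub>N\<^esub> x)"]) (auto simp: carrier_quotient add zero l_neg)
  qed (auto simp: carrier_quotient add zero a_ac)
  show "group_hom (add_monoid N) (add_monoid quotient) proj"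
    using abelian_group.a_group[OF quot] a_group
    by (auto simp: group_hom_def group_hom_axioms_def hom_def carrier_quotient add)
qed (rule abelian_group_axioms)

sublocale Q: abelian_group_hom N quotient proj
  by (rule proj_hom)

lemma proj_eq_iff: "x \<in> carrier N \<Longrightarrow> y \<in> carrier N \<Longrightarrow> proj x = proj y \<longleftrightarrow> x \<ominus>\<^bsub>N\<^esub> y \<in> L"
  by (rule rcos_eq_iff[OF L_subgroup])

text \<open>
  The scalar action on cosets is defined as a union over representatives, all of whose contributions
  coincide because \<open>L\<close> is stable under \<open>R\<close>.
\<close>
lemma proj_smult:
  assumes "a \<in> carrier R" "x \<in> carrier N"
  shows "a \<odot>\<^bsub>quotient\<^esub> proj x = proj (a \<odot>\<^bsub>N\<^esub> x)"
proof -
  have eq: "proj (a \<odot>\<^bsub>N\<^esub> y) = proj (a \<odot>\<^bsub>N\<^esub> x)" if y: "y \<in> proj x" for y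
  proof -
    have carr: "y \<in> carrier N"
      using y assms(2) L.a_elemrcos_carrier by blast
    have "y \<ominus>\<^bsub>N\<^esub> x \<in> L"
      using y assms(2) L.a_rcos_module_imp by (simp add: minus_eq)
    thus ?thesis
      using L assms carr by (simp add: proj_eq_iff smult_closed submodule_iff flip: smult_r_minus_distr)
  qed
  have "a \<odot>\<^bsub>quotient\<^esub> proj x = (\<Union>y\<in>proj x. proj (a \<odot>\<^bsub>N\<^esub> y))"
    by (simp add: quot_module_def)
  also have "\<dots> = (\<Union>y\<in>proj x. proj (a \<odot>\<^bsub>N\<^esub> x))"
    by (intro SUP_cong refl eq)
  also have "\<dots> = proj (a \<odot>\<^bsub>N\<^esub> x)"
    using L.a_rcos_self[OF assms(2)] by (intro UN_constant[THEN trans]) auto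
  finally show ?thesis .
qed

lemma proj_sum_multiples:
  assumes "finite J" "y \<in> J \<rightarrow> carrier N" "\<And>j. j \<in> J \<Longrightarrow> C j \<subseteq> carrier R"
  shows "sum_multiples quotient J C (\<lambda>j. proj (y j)) = proj ` sum_multiples N J C y"
proof -
  have sum: "(\<Oplus>\<^bsub>quotient\<^esub>j\<in>J. a j \<odot>\<^bsub>quotient\<^esub> proj (y j)) = proj (\<Oplus>\<^bsub>N\<^esub>j\<in>J. a j \<odot>\<^bsub>N\<^esub> y j)"
    if "\<forall>j\<in>J. a j \<in> C j" for a
    using assms that
  proof (induction J rule: finite_induct)
    case (insert i J)
    have "(\<lambda>j. a j \<odot>\<^bsub>N\<^esub> y j) \<in> insert i J \<rightarrow> carrier N"
      using insert.prems by (auto intro!: smult_closed)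
    moreover have smult: "a j \<odot>\<^bsub>quotient\<^esub> proj (y j) = proj (a j \<odot>\<^bsub>N\<^esub> y j)" if "j \<in> insert i J" for j
      using insert.prems that by (intro proj_smult) auto
    moreover have "(\<lambda>j. a j \<odot>\<^bsub>quotient\<^esub> proj (y j)) \<in> insert i J \<rightarrow> carrier quotient"
      using calculation(1) smult by (auto simp: Pi_iff intro!: Q.hom_closed)
    ultimately show ?case
      using insert by (simp add: Pi_iff)
  qed simp
  show ?thesis
  proof (intro equalityI subsetI)
    fix X assume "X \<in> sum_multiples quotient J C (\<lambda>j. proj (y j))"
    then obtain a where "\<forall>j\<in>J. a j \<in> C j" "X = (\<Oplus>\<^bsub>quotient\<^esub>j\<in>J. a j \<odot>\<^bsub>quotient\<^esub> proj (y j))"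
      unfolding sum_multiples_def by blast
    thus "X \<in> proj ` sum_multiples N J C y"
      using sum unfolding sum_multiples_def by blast
  next
    fix X assume "X \<in> proj ` sum_multiples N J C y"
    then obtain a where "\<forall>j\<in>J. a j \<in> C j" "X = proj (\<Oplus>\<^bsub>N\<^esub>j\<in>J. a j \<odot>\<^bsub>N\<^esub> y j)"
      unfolding sum_multiples_def by blast
    thus "X \<in> sum_multiples quotient J C (\<lambda>j. proj (y j))"
      using sum[symmetric] unfolding sum_multiples_def by blast
  qed
qed

text \<open>
  The scalars \<open>S\<close> may be fewer than those of \<open>R\<close>, so that the projection modulo an \<open>A\<close>-submodule can be
  applied to modules over \<open>F\<^sub>0A\<close>.  Images and preimages of \<open>S\<close>-submodules are \<open>S\<close>-submodules, which gives
  the two inclusions.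
\<close>
lemma proj_gen_submodule:
  assumes S: "carrier S \<subseteq> carrier R" and Y: "Y \<subseteq> carrier N"
  shows "gen_submodule S quotient (proj ` Y) = proj ` gen_submodule S N Y"
proof
  let ?H = "gen_submodule S N Y"
  have H: "additive_subgroup ?H N" "\<And>a x. a \<in> carrier S \<Longrightarrow> x \<in> ?H \<Longrightarrow> a \<odot>\<^bsub>N\<^esub> x \<in> ?H"
    using submodule_gen_submodule[OF assms] by (auto simp: submodule_iff)
  have "subgroup (proj ` ?H) (add_monoid quotient)"
    using group_hom.subgroup_img_is_subgroup[OF Q.a_group_hom] H(1)
    by (simp add: additive_subgroup_def)
  moreover have "a \<odot>\<^bsub>quotient\<^esub> X \<in> proj ` ?H" if "a \<in> carrier S" "X \<in> proj ` ?H" for a X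
  proof -
    from that obtain x where "x \<in> ?H" "X = proj x" by blast
    thus ?thesis
      using that S H proj_smult additive_subgroup.a_Hcarr[OF H(1)] by auto
  qed
  ultimately have "submodule (proj ` ?H) S quotient"
    by (simp add: submodule_def submodule_axioms_def)
  thus "gen_submodule S quotient (proj ` Y) \<subseteq> proj ` ?H"
    by (rule gen_submodule_minimal) (intro image_mono subset_gen_submodule)
next
  show "proj ` gen_submodule S N Y \<subseteq> gen_submodule S quotient (proj ` Y)"
  proof (clarsimp simp: gen_submodule_def[of S quotient])
    fix x K assume x: "x \<in> gen_submodule S N Y" and K: "submodule K S quotient" "proj ` Y \<subseteq> K"
    interpret K: submodule K S quotient by (rule K(1))
    have Ks: "additive_subgroup K quotient"
      using K(1) by (simp add: submodule_def additive_subgroup_def)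
    let ?P = "{x \<in> carrier N. proj x \<in> K}"
    have "additive_subgroup ?P N"
      unfolding additive_subgroup_def
    proof (rule add.subgroupI)
      show "?P \<noteq> {}"
        using additive_subgroup.zero_closed[OF Ks] Q.hom_zero by (metis (mono_tags, lifting) empty_Collect_eq zero_closed)
    qed (auto simp: additive_subgroup.a_closed[OF Ks] additive_subgroup.a_inv_closed[OF Ks])
    hence "submodule ?P S N"
      using S K.smult_closed by (auto simp: submodule_iff smult_closed proj_smult[symmetric])
    hence "gen_submodule S N Y \<subseteq> ?P"
      by (rule gen_submodule_minimal) (use Y K(2) in auto)
    thus "proj x \<in> K" using x by blast
  qed
qed

lemma proj_image_eqI:
  assumes "H <+>\<^bsub>N\<^esub> L = K <+>\<^bsub>N\<^esub> L" "H \<subseteq> carrier N" "K \<subseteq> carrier N"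
  shows "proj ` H = proj ` K"
proof -
  have "proj ` (H <+>\<^bsub>N\<^esub> L) = proj ` H" if H: "H \<subseteq> carrier N" for H
  proof -
    have eq: "proj (h \<oplus>\<^bsub>N\<^esub> l) = proj h" if "h \<in> H" "l \<in> L" for h l
    proof -
      have "(h \<oplus>\<^bsub>N\<^esub> l) \<ominus>\<^bsub>N\<^esub> h = l"
        using that H by (simp add: minus_eq a_comm[of h l] a_assoc r_neg subset_iff)
      thus ?thesis
        using that H by (subst proj_eq_iff) auto
    qed
    have "proj ` (H <+>\<^bsub>N\<^esub> L) = (\<Union>h\<in>H. \<Union>l\<in>L. {proj (h \<oplus>\<^bsub>N\<^esub> l)})"
      by (auto simp: set_add_def')
    also have "\<dots> = (\<Union>h\<in>H. \<Union>l\<in>L. {proj h})"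
      using eq by (intro SUP_cong) auto
    also have "\<dots> = proj ` H"
      using L.zero_closed by blast
    finally show ?thesis .
  qed
  thus ?thesis
    using assms by metis
qed

end


section \<open>Free modules\<close>

lemma left_module_free_module:
  assumes "ring R"
  shows "left_module R (free_module R E)"
proof -
  interpret ring R by (rule assms)
  have "abelian_group (free_module R E)"
  proof (rule abelian_groupI)
    fix x assume "x \<in> carrier (free_module R E)"
    thus "\<exists>y\<in>carrier (free_module R E). y \<oplus>\<^bsub>free_module R E\<^esub> x = \<zero>\<^bsub>free_module R E\<^esub>"
      by (intro bexI[of _ "\<lambda>e\<in>E. \<ominus>\<^bsub>R\<^esub> x e"]) (auto simp: free_module_def l_neg PiE_iff)
  qed (auto simp: free_module_def PiE_iff a_ac extensional_def)
  thus ?thesis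
    unfolding left_module_def left_module_axioms_def
    using assms by (auto simp: free_module_def PiE_iff l_distr r_distr m_assoc extensional_def)
qed

lemma a_inv_free_module:
  assumes "ring R" "x \<in> carrier (free_module R E)"
  shows "\<ominus>\<^bsub>free_module R E\<^esub> x = (\<lambda>e\<in>E. \<ominus>\<^bsub>R\<^esub> x e)"
proof -
  interpret ring R by (rule assms)
  interpret N: left_module R "free_module R E" by (rule left_module_free_module[OF assms(1)])
  have "(\<lambda>e\<in>E. \<ominus>\<^bsub>R\<^esub> x e) \<oplus>\<^bsub>free_module R E\<^esub> x = \<zero>\<^bsub>free_module R E\<^esub>"
      "(\<lambda>e\<in>E. \<ominus>\<^bsub>R\<^esub> x e) \<in> carrier (free_module R E)"
    using assms(2) by (auto simp: free_module_def l_neg PiE_iff)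
  thus ?thesis using assms(2) N.minus_equality by metis
qed


section \<open>Weight filtrations of PBW-reduction-algebras\<close>

lemma words_add: "m \<in> words n \<Longrightarrow> m' \<in> words n \<Longrightarrow> m + m' \<in> words n"
  by (auto simp: words_def plus_word_def)

lemma zero_in_words: "0 \<in> words n"
  by (simp add: words_def zero_word_def)

lemma std_word_in_words: "\<alpha> \<in> expos n \<Longrightarrow> std_word \<alpha> \<in> words n"
  by (auto simp: expos_def std_word_def words_def)

lemma carrier_free_alg_iff: "f \<in> carrier (free_alg n) \<longleftrightarrow> Poly_Mapping.keys f \<subseteq> words n"
  by (simp add: free_alg_def)

lemma ring_free_alg: "ring (free_alg n :: 'k::field falg ring)"
proof (rule ringI)
  show "abelian_group (free_alg n :: 'k falg ring)"
  proof (rule abelian_groupI)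
    fix f :: "'k falg" assume "f \<in> carrier (free_alg n)"
    thus "\<exists>g\<in>carrier (free_alg n). g \<oplus>\<^bsub>free_alg n\<^esub> f = \<zero>\<^bsub>free_alg n\<^esub>"
      by (intro bexI[of _ "- f"]) (auto simp: free_alg_def)
  qed (use keys_add in \<open>auto simp: free_alg_def ac_simps, fast?\<close>)
  show "monoid (free_alg n :: 'k falg ring)"
  proof
    fix f g :: "'k falg" assume "f \<in> carrier (free_alg n)" "g \<in> carrier (free_alg n)"
    thus "f \<otimes>\<^bsub>free_alg n\<^esub> g \<in> carrier (free_alg n)"
      using keys_mult[of f g] words_add by (fastforce simp: free_alg_def)
  qed (auto simp: free_alg_def mult.assoc zero_in_words)
qed (auto simp: free_alg_def distrib_left distrib_right)

lemma std_polys_carrier: "std_polys n \<subseteq> carrier (free_alg n)"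
  using std_word_in_words by (fastforce simp: std_polys_def carrier_free_alg_iff)

lemma mon_in_carrier: "m \<in> words n \<Longrightarrow> mon m \<in> carrier (free_alg n)"
  by (simp add: carrier_free_alg_iff)

lemma free_alg_diff:
  assumes "f \<in> carrier (free_alg n)" "g \<in> carrier (free_alg n)"
  shows "f - g \<in> carrier (free_alg n)"
  using assms keys_diff[of f g] by (auto simp: carrier_free_alg_iff)

text \<open>
  The relations have to involve only the letters below \<open>n\<close> in order to generate an ideal of
  \<open>K\<langle>x\<^sub>1, \<dots>, x\<^sub>n\<rangle>\<close>.
\<close>
lemma comm_rels_carrier:
  assumes "\<And>i j. i < j \<Longrightarrow> j < n \<Longrightarrow> d i j \<in> std_polys n"
  shows "comm_rels n c d \<subseteq> carrier (free_alg n)"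
proof -
  have "const (c i j) * mon (Word [i, j]) \<in> carrier (free_alg n)" if "i < j" "j < n" for i j
  proof -
    have "const (c i j) * mon (Word [i, j]) = Poly_Mapping.single (Word [i, j]) (c i j)"
      by (simp add: mult_single)
    thus ?thesis using that by (simp add: carrier_free_alg_iff words_def)
  qed
  thus ?thesis
    using assms std_polys_carrier[of n]
    by (auto simp: comm_rels_def words_def intro!: free_alg_diff mon_in_carrier)
qed

lemma pbw_ideal_ideal:
  assumes "pbw_reduction_datum D"
  shows "ideal (pbw_ideal D) (free_alg (nvars D))"
proof -
  have "rels D \<subseteq> carrier (free_alg (nvars D))"
    using assms std_polys_carrier by (auto simp: pbw_reduction_datum_def)
  moreover have "comm_rels (nvars D) (ccoef D) (dpoly D) \<subseteq> carrier (free_alg (nvars D))"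
    using assms by (intro comm_rels_carrier) (auto simp: pbw_reduction_datum_def commutation_system_def)
  ultimately show ?thesis
    unfolding pbw_ideal_def by (intro ring.genideal_ideal ring_free_alg) auto
qed

lemma cls_ring_hom:
  assumes "pbw_reduction_datum D"
  shows "ring_hom_ring (free_alg (nvars D)) (pbw_alg D) (cls D)"
  using ideal.rcos_ring_hom_ring[OF pbw_ideal_ideal[OF assms]]
  by (simp add: pbw_alg_def cls_def[abs_def])

lemma carrier_pbw_alg: "carrier (pbw_alg D) = cls D ` carrier (free_alg (nvars D))"
  by (auto simp: pbw_alg_def FactRing_def A_RCOSETS_def' cls_def)

lemma a_inv_free_alg:
  fixes f :: "'k::field falg"
  assumes "f \<in> carrier (free_alg n)"
  shows "\<ominus>\<^bsub>free_alg n\<^esub> f = - f"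
proof -
  interpret ring "free_alg n :: 'k falg ring" by (rule ring_free_alg)
  have "- f \<oplus>\<^bsub>free_alg n\<^esub> f = \<zero>\<^bsub>free_alg n\<^esub>" "- f \<in> carrier (free_alg n)"
    using assms by (auto simp: free_alg_def)
  thus ?thesis using assms minus_equality by metis
qed

lemma wdeg_le_iff: "wdeg u f \<le> k \<longleftrightarrow> (\<forall>m \<in> Poly_Mapping.keys f. ext (word_wt u m) \<le> k)"
  by (simp add: wdeg_def SUP_le_iff)

lemma wdeg_vec_le_iff:
  "wdeg_vec E u s f \<le> k \<longleftrightarrow> (\<forall>e \<in> E. \<forall>m \<in> Poly_Mapping.keys (f e). ext (word_wt u m + s e) \<le> k)"
  by (auto simp: wdeg_vec_def SUP_le_iff)

lemma Fil_subgroup: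
  fixes D :: "'k::field pbw_datum"
  assumes D: "pbw_reduction_datum D"
  shows "additive_subgroup (Fil D u k) (pbw_alg D)"
proof -
  interpret h: ring_hom_ring "free_alg (nvars D)" "pbw_alg D" "cls D"
    by (rule cls_ring_hom[OF D])
  let ?H = "{f \<in> carrier (free_alg (nvars D) :: 'k falg ring). wdeg u f \<le> k}"
  have "subgroup ?H (add_monoid (free_alg (nvars D)))"
  proof (rule h.R.add.subgroupI)
    show "?H \<noteq> {}"
      by (auto simp: carrier_free_alg_iff wdeg_le_iff intro!: exI[of _ 0])
  next
    fix f assume "f \<in> ?H"
    thus "\<ominus>\<^bsub>free_alg (nvars D)\<^esub> f \<in> ?H"
      by (auto simp: a_inv_free_alg carrier_free_alg_iff wdeg_le_iff)
  next
    fix f g assume fg: "f \<in> ?H" "g \<in> ?H"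
    hence "f \<oplus>\<^bsub>free_alg (nvars D)\<^esub> g = f + g"
      by (simp add: free_alg_def)
    thus "f \<oplus>\<^bsub>free_alg (nvars D)\<^esub> g \<in> ?H"
      using fg keys_add[of f g] by (auto simp: carrier_free_alg_iff wdeg_le_iff)
  qed auto
  thus ?thesis
    using group_hom.subgroup_img_is_subgroup[OF h.a_group_hom]
    by (simp add: additive_subgroup_def Fil_def)
qed

lemma Fil_vec_mono: "k \<le> l \<Longrightarrow> Fil_vec D E u s k \<subseteq> Fil_vec D E u s l"
  unfolding Fil_vec_def by (intro image_mono) (auto intro: order_trans)

lemma Fil_vec_subgroup:
  fixes D :: "'k::field pbw_datum"
  assumes D: "pbw_reduction_datum D"
  shows "additive_subgroup (Fil_vec D E u s k) (free_module (pbw_alg D) E)" (is "additive_subgroup ?F ?N")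
proof -
  interpret h: ring_hom_ring "free_alg (nvars D)" "pbw_alg D" "cls D"
    by (rule cls_ring_hom[OF D])
  interpret N: left_module "pbw_alg D" ?N
    by (rule left_module_free_module[OF h.S.ring_axioms])
  let ?H = "{f \<in> E \<rightarrow> carrier (free_alg (nvars D) :: 'k falg ring). wdeg_vec E u s f \<le> k}"
  let ?c = "\<lambda>f. \<lambda>e\<in>E. cls D (f e)"
  have F: "?F = ?c ` ?H" by (simp add: Fil_vec_def)
  have carr: "?c f \<in> carrier ?N" if "f \<in> ?H" for f
    using that by (auto simp: free_module_def Pi_iff)
  show ?thesis
    unfolding additive_subgroup_def
  proof (rule N.add.subgroupI)
    show "?F \<subseteq> carrier ?N" unfolding F using carr by blast
    have "(\<lambda>_. 0) \<in> ?H"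
      by (auto simp: carrier_free_alg_iff wdeg_vec_le_iff)
    thus "?F \<noteq> {}" unfolding F by blast
  next
    fix x assume "x \<in> ?F"
    then obtain f where f: "f \<in> ?H" "x = ?c f" unfolding F by blast
    have "\<ominus>\<^bsub>?N\<^esub> x = ?c (\<lambda>e. - f e)"
      unfolding f(2) a_inv_free_module[OF h.S.ring_axioms carr[OF f(1)]]
    proof (rule restrict_ext)
      fix e assume e: "e \<in> E"
      hence "f e \<in> carrier (free_alg (nvars D))" using f by auto
      thus "\<ominus>\<^bsub>pbw_alg D\<^esub> (?c f e) = cls D (- f e)"
        using e by (simp flip: a_inv_free_alg)
    qed
    moreover have "(\<lambda>e. - f e) \<in> ?H"
      using f by (auto simp: carrier_free_alg_iff wdeg_vec_le_iff Pi_iff)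
    ultimately show "\<ominus>\<^bsub>?N\<^esub> x \<in> ?F" unfolding F by (rule image_eqI)
  next
    fix x y assume "x \<in> ?F" "y \<in> ?F"
    then obtain f g where f: "f \<in> ?H" "x = ?c f" and g: "g \<in> ?H" "y = ?c g" unfolding F by blast
    have "x \<oplus>\<^bsub>?N\<^esub> y = (\<lambda>e\<in>E. ?c f e \<oplus>\<^bsub>pbw_alg D\<^esub> ?c g e)"
      by (simp add: f g free_module_def)
    also have "\<dots> = ?c (\<lambda>e. f e + g e)"
    proof (rule restrict_ext)
      fix e assume e: "e \<in> E"
      hence fg: "f e \<in> carrier (free_alg (nvars D))" "g e \<in> carrier (free_alg (nvars D))"
        using f g by auto
      have "f e + g e = f e \<oplus>\<^bsub>free_alg (nvars D)\<^esub> g e"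
        by (simp add: free_alg_def)
      thus "?c f e \<oplus>\<^bsub>pbw_alg D\<^esub> ?c g e = cls D (f e + g e)"
        using e fg by simp
    qed
    finally have "x \<oplus>\<^bsub>?N\<^esub> y = ?c (\<lambda>e. f e + g e)" .
    moreover have "(\<lambda>e. f e + g e) \<in> ?H"
    proof -
      have "m \<in> words (nvars D) \<and> ext (word_wt u m + s e) \<le> k"
        if "e \<in> E" "m \<in> Poly_Mapping.keys (f e + g e)" for e m
      proof -
        have "m \<in> Poly_Mapping.keys (f e) \<or> m \<in> Poly_Mapping.keys (g e)"
          using that(2) keys_add[of "f e" "g e"] by blast
        thus ?thesis
          using that(1) f(1) g(1) by (auto simp: carrier_free_alg_iff wdeg_vec_le_iff Pi_iff)
      qed
      thus ?thesis
        by (simp add: carrier_free_alg_iff wdeg_vec_le_iff Pi_iff subset_iff)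
    qed
    ultimately show "x \<oplus>\<^bsub>?N\<^esub> y \<in> ?F" unfolding F by (rule image_eqI)
  qed
qed

text \<open>
  An element of \<open>A\<^sup>E\<close> has a representative involving finitely many monomials in finitely many
  components, so their degrees are bounded.
\<close>
lemma Fil_vec_exhaustive:
  assumes "finite E" "x \<in> carrier (free_module (pbw_alg D) E)"
  shows "\<exists>l::int. x \<in> Fil_vec D E u s (ext l)"
proof -
  have x: "\<forall>e\<in>E. \<exists>f. f \<in> carrier (free_alg (nvars D)) \<and> x e = cls D f" "x \<in> extensional E"
    using assms(2) by (auto simp: free_module_def carrier_pbw_alg PiE_iff)
  then obtain f where f: "\<And>e. e \<in> E \<Longrightarrow> f e \<in> carrier (free_alg (nvars D)) \<and> x e = cls D (f e)"
    by metis
  let ?W = "(\<lambda>(e, m). word_wt u m + s e) ` (SIGMA e:E. Poly_Mapping.keys (f e))"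
  have fin: "finite ?W" using assms(1) by auto
  \<comment> \<open>The inserted \<open>0\<close> covers the case that there are no monomials at all.\<close>
  have "word_wt u m + s e \<le> Max (insert 0 ?W)" if "e \<in> E" "m \<in> Poly_Mapping.keys (f e)" for e m
    using that fin by (intro Max_ge) force+
  hence "wdeg_vec E u s f \<le> ext (Max (insert 0 ?W))"
    unfolding wdeg_vec_le_iff ereal_less_eq of_int_le_iff by blast
  moreover have "x = (\<lambda>e\<in>E. cls D (f e))"
    using f x(2) by (intro extensionalityI[of _ E]) auto
  moreover have "f \<in> E \<rightarrow> carrier (free_alg (nvars D))"
    using f by blast
  ultimately show ?thesis
    unfolding Fil_vec_def by blast
qed

lemma filtered_free_module:
  assumes D: "pbw_reduction_datum D" and E: "finite E"
  shows "filtered_abelian_group (free_module (pbw_alg D) E) (\<lambda>l. Fil_vec D E u s (ext l))"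
proof -
  interpret h: ring_hom_ring "free_alg (nvars D)" "pbw_alg D" "cls D"
    by (rule cls_ring_hom[OF D])
  interpret N: left_module "pbw_alg D" "free_module (pbw_alg D) E"
    by (rule left_module_free_module[OF h.S.ring_axioms])
  show ?thesis
    by (intro filtered_abelian_group.intro filtered_abelian_group_axioms.intro
        N.abelian_group_axioms Fil_vec_subgroup[OF D] Fil_vec_mono Fil_vec_exhaustive[OF E]) auto
qed

lemma Gr_sub_eq_gr_image:
  assumes "pbw_reduction_datum D" "finite E"
  shows "Gr_sub D E u s N =
    filtered_abelian_group.gr_image (free_module (pbw_alg D) E) (\<lambda>l. Fil_vec D E u s (ext l)) N"
  by (simp add: Gr_sub_def filtered_abelian_group.gr_image_def[OF filtered_free_module[OF assms]])


section \<open>The filtration of a submodule of a quotient\<close>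

theorem corollary4p10:
  fixes D Dv DG DGv :: "'k::field pbw_datum"
    and v w wv :: "nat \<Rightarrow> int"
    and G GG :: "expo list"
    and P :: "int \<Rightarrow> expo set"
    and t :: "int \<Rightarrow> expo \<Rightarrow> int"
    and r3 rw :: "expo rel"
    and E :: "'e set"
    and s :: "'e \<Rightarrow> int"
    and k :: int
    and X V' Vk' Vk L :: "('e \<Rightarrow> 'k falg set) set"
    and V :: "('e \<Rightarrow> 'k falg set) set set"
    and cl :: "('e \<Rightarrow> 'k falg set) \<Rightarrow> ('e \<Rightarrow> 'k falg set) set"
    and A F0A AE M FwM
  defines "A \<equiv> pbw_alg D"
    and "F0A \<equiv> F0_ring D v"
    and "AE \<equiv> free_module A E"
    and "L \<equiv> gen_submodule A AE X"
    and "M \<equiv> quot_module AE L"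
    and "cl \<equiv> (\<lambda>a. L +>\<^bsub>AE\<^esub> a)"
    and "FwM \<equiv> (\<lambda>l::int. cl ` Fil_vec D E w s (ext l))"
    and "V \<equiv> gen_submodule F0A M (cl ` V')"
    and "Vk \<equiv> sum_multiples AE Vk' (\<lambda>_. Fil D v 0) (\<lambda>x. x)"
  assumes "pbw_reduction_datum D"
    and "weight_vector D v" and "weight_vector D w"
    and "Fil D w 0 \<subseteq> Fil D v 0"
    and "generates_F0 D v G"
    and "\<And>d. finite (P d) \<and> P d \<subseteq> expos (nvars D) \<and>
           gen_submodule F0A (self_module A) ((\<lambda>p. cls D (mon (std_word p))) ` P d) = Fil D v (ext d)"
    and standing1: "has_computable_weight_ordering D v"
    and standing2: "presents_F0 D G Dv"
    and standing3: "weight_vector Dv wv"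
           "\<And>l::int. (\<lambda>f. cls D (subst_mons G f)) `
                {f \<in> carrier (free_alg (nvars Dv)). wdeg wv f \<le> ext l} =
              Fil D w (ext l) \<inter> Fil D v 0"
           "has_computable_weight_ordering Dv wv"
    and standing4: "\<And>d l::int. Fil D w (ext l) \<inter> Fil D v (ext d) =
           sum_multiples (self_module A) (P d) (\<lambda>p. Fil D w (ext (l - t d p)) \<inter> Fil D v 0)
             (\<lambda>p. cls D (mon (std_word p)))"
    and standing5: "\<And>l::int. Fil D v 0 \<inter> Fil D w (ext l) =
           cls D ` {p \<in> std_polys (nvars D). wdeg v p \<le> 0 \<and> wdeg w p \<le> ext l}"
    and standing6: "ordering_on D r3" "well_ordering (nvars D) r3"
           "computable_ordering D (weight_order (nvars D) w r3)"
    and standing7: "presents_Gr D w DG" "has_computable_weight_ordering DG v"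
           "generates_F0 DG v GG" "presents_F0 DG GG DGv"
    and "finite E"
    and "finite X" "X \<subseteq> carrier AE"
    and "finite V'" "V' \<subseteq> carrier AE"
    and "\<exists>(N::nat) m r. (\<forall>i<N. m i \<in> V) \<and>
           (\<forall>l::int. V \<inter> FwM l =
              sum_multiples M {..<N} (\<lambda>i. Fil D w (ext (l - r i)) \<inter> Fil D v 0) m)"
    and "gen_submodule F0A M (V \<inter> FwM k) = V"
    and "finite Vk'" "Vk' \<subseteq> carrier AE"
    and i: "Vk <+>\<^bsub>AE\<^esub> L = gen_submodule F0A AE V' <+>\<^bsub>AE\<^esub> L"
    and ii: "\<And>k'::int. k' \<le> k \<Longrightarrow> V \<inter> FwM k' =
           sum_multiples M Vk' (\<lambda>x. Fil D w (ext k' - deg_vec D E w s x) \<inter> Fil D v 0) cl"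
    and iii: "\<And>l::int. Vk \<inter> Fil_vec D E w s (ext l) =
           sum_multiples AE Vk' (\<lambda>x. Fil D w (ext l - deg_vec D E w s x) \<inter> Fil D v 0) (\<lambda>x. x)"
  shows "(\<forall>l::int. V \<inter> FwM l =
            sum_multiples M Vk' (\<lambda>x. Fil D w (ext l - deg_vec D E w s x) \<inter> Fil D v 0) cl) \<longleftrightarrow>
         Gr_sub D E w s Vk \<inter> Gr_sub D E w s L = Gr_sub D E w s (Vk \<inter> L)"
proof -
  have D: "pbw_reduction_datum D" and E: "finite E" and X: "X \<subseteq> carrier AE"
    and V': "V' \<subseteq> carrier AE" and Vk': "finite Vk'" "Vk' \<subseteq> carrier AE"
    by fact+
  interpret h: ring_hom_ring "free_alg (nvars D)" A "cls D"
    unfolding A_def by (rule cls_ring_hom[OF D])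
  interpret N: left_module A AE
    unfolding AE_def by (rule left_module_free_module[OF h.S.ring_axioms])
  interpret N: submodule_of_left_module A AE L
    by (intro submodule_of_left_module.intro submodule_of_left_module_axioms.intro
        N.left_module_axioms) (simp add: L_def N.submodule_gen_submodule X)
  interpret F: filtered_abelian_group AE "\<lambda>l. Fil_vec D E w s (ext l)"
    unfolding AE_def A_def by (rule filtered_free_module[OF D E])
  have Fil: "additive_subgroup (Fil D u l) A" for u l
    unfolding A_def by (rule Fil_subgroup[OF D])
  have Vk: "additive_subgroup Vk AE"
    unfolding Vk_def using Vk' Fil by (intro N.subgroup_sum_multiples) auto
  have F0A: "carrier F0A \<subseteq> carrier A"
    using additive_subgroup.a_subset[OF Fil] by (simp add: F0A_def F0_ring_def)
  have "gen_submodule F0A AE V' \<subseteq> carrier AE"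
    using N.submodule_gen_submodule[OF F0A V'] additive_subgroup.a_subset
    by (auto simp: N.submodule_iff)
  hence "cl ` Vk = cl ` gen_submodule F0A AE V'"
    unfolding cl_def
    using i additive_subgroup.a_subset[OF Vk] by (intro N.proj_image_eqI)
  \<comment> \<open>By (i), \<open>V\<close> is the image of \<open>V\<^sub>k\<close> under the projection modulo \<open>L\<close>.\<close>
  hence V: "V = cl ` Vk"
    unfolding V_def M_def cl_def using N.proj_gen_submodule[OF F0A V'] by simp
  \<comment> \<open>By (iii), the sum generated by the classes is the image of the filtration step of \<open>V\<^sub>k\<close>.\<close>
  have "sum_multiples M Vk' (\<lambda>x. Fil D w (ext l - deg_vec D E w s x) \<inter> Fil D v 0) cl =
      cl ` (Vk \<inter> Fil_vec D E w s (ext l))" for l :: int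
    unfolding iii M_def cl_def
    using Vk' additive_subgroup.a_subset[OF Fil] by (intro N.proj_sum_multiples) auto
  hence "(\<forall>l::int. V \<inter> FwM l =
        sum_multiples M Vk' (\<lambda>x. Fil D w (ext l - deg_vec D E w s x) \<inter> Fil D v 0) cl) \<longleftrightarrow>
      (\<forall>l::int. cl ` Vk \<inter> cl ` Fil_vec D E w s (ext l) = cl ` (Vk \<inter> Fil_vec D E w s (ext l)))"
    by (simp add: V FwM_def)
  also have "\<dots> \<longleftrightarrow> F.gr_image Vk \<inter> F.gr_image L = F.gr_image (Vk \<inter> L)"
    unfolding cl_def by (rule F.strict_iff_gr_image_Int[OF Vk N.L_subgroup])
  finally show ?thesis
    unfolding AE_def A_def Gr_sub_eq_gr_image[OF D E] .
qed

end
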